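(* Let $\mathbb{X}$ and $\mathbb{Y}$ be compact subsets of $\mathbb{R}^n$ with non-empty interior, and let $c:\mathbb{X}\times\mathbb{Y}\to\mathbb{R}$ be a $C^2$ function (in the sense that $D_xc$, $D_yc$, $D^2_{xy}c$, $D^2_{yx}c$ exist and are continuous on $\mathbb{X}\times\mathbb{Y}$ and $D^2_{xy}c=(D^2_{yx}c)^T$) which is bi-twisted and non-degenerate. Assume that $\mathbb{X}$ is $c$-convex with respect to $\mathbb{Y}$ and $\mathbb{Y}$ is $c$-convex with respect to $\mathbb{X}$. Then: (1) If $c$ satisfies Loeper's property, then a function $\phi:\mathbb{X}\to\mathbb{R}$ is $c$-convex if and only if it is alternative $c$-convex. (2) If $c$ does not satisfy Loeper's property, then there exists a function $\phi:\mathbb{X}\to\mathbb{R}$ that is alternative $c$-convex but not $c$-convex.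
   Context: Bi-twist: for each $x\in\mathbb{X}$ the map $y\mapsto -D_xc(x,y)$ is injective on $\mathbb{Y}$, and for each $y\in\mathbb{Y}$ the map $x\mapsto -D_yc(x,y)$ is injective on $\mathbb{X}$. Non-degenerate: $D^2_{xy}c(x,y)$ is invertible for every $(x,y)\in\mathbb{X}\times\mathbb{Y}$. For $y\in\mathbb{Y}$ let $[\mathbb{X}]_y=\{-D_yc(x,y):x\in\mathbb{X}\}$ and for $x\in\mathbb{X}$ let $[\mathbb{Y}]_x=\{-D_xc(x,y):y\in\mathbb{Y}\}$; $\mathbb{X}$ is $c$-convex with respect to $\mathbb{Y}$ if $[\mathbb{X}]_y$ is convex for every $y\in\mathbb{Y}$, and $\mathbb{Y}$ is $c$-convex with respect to $\mathbb{X}$ if $[\mathbb{Y}]_x$ is convex for every $x\in\mathbb{X}$. For $y\in\mathbb{Y}$, $\exp^c_y:[\mathbb{X}]_y\to\mathbb{X}$ denotes the inverse of $x\mapsto -D_yc(x,y)$. For $x_0,x_1\in\mathbb{X}$, $y\in\mathbb{Y}$, $p_i=-D_yc(x_i,y)$, the $c$-segment with respect to $y$ from $x_0$ to $x_1$ is $\{x_t=\exp^c_y(tp_1+(1-t)p_0): t\in[0,1]\}$. Loeper's property: for all $x_0,x_1\in\mathbb{X}$, $y_0,y\in\mathbb{Y}$ and every point $x_t$ of the $c$-segment with respect to $y_0$ from $x_0$ to $x_1$, one has $-c(x_t,y)+c(x_t,y_0)\le\max\{-c(x_i,y)+c(x_i,y_0): i=0,1\}$. $c$-convex function: $\phi:\mathbb{X}\to\mathbb{R}$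 is $c$-convex if $\phi(x)=\sup_{y\in\mathbb{Y}}\{-c(x,y)+\psi(y)\}$ for some $\psi:\mathbb{Y}\to\mathbb{R}\cup\{-\infty\}$ not identically $-\infty$. $c$-chord: for $X_i=(x_i,u_i)\in\mathbb{X}\times\mathbb{R}$, $i=0,1$, $F_{X_0X_1}(x)=\sup\{-c(x,y)+h: y\in\mathbb{Y}, h\in\mathbb{R}, -c(x_i,y)+h\le u_i \text{ for } i=0,1\}$ for $x\in\mathbb{X}$. Alternative $c$-convex: $\phi:\mathbb{X}\to\mathbb{R}$ is alternative $c$-convex if for all $x_0,x_1\in\mathbb{X}$, with $X_i=(x_i,\phi(x_i))$, one has $\phi(x)\le F_{X_0X_1}(x)$ for all $x\in\mathbb{X}$. *)

theory Defs
  imports "HOL-Analysis.Analysis"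
begin

text \<open>Cost c on X x Y with points of X, Y in real^'n.  Dxc x y and Dyc x y are the
  gradients of c in x and in y; Dxy x y is the matrix with entries
  d^2 c / (dx_i dy_j), Dyx x y the matrix with entries d^2 c / (dy_j dx_i).\<close>

definition bi_twisted ::
  "'a set \<Rightarrow> 'b set \<Rightarrow> ('a \<Rightarrow> 'b \<Rightarrow> 'c::real_normed_vector)
    \<Rightarrow> ('a \<Rightarrow> 'b \<Rightarrow> 'd::real_normed_vector) \<Rightarrow> bool" where
  "bi_twisted X Y Dxc Dyc \<longleftrightarrow>
     (\<forall>x\<in>X. inj_on (\<lambda>y. - Dxc x y) Y) \<and> (\<forall>y\<in>Y. inj_on (\<lambda>x. - Dyc x y) X)"

definition non_degenerate ::
  "'a set \<Rightarrow> 'b set \<Rightarrow> ('a \<Rightarrow> 'b \<Rightarrow> real^'n^'n) \<Rightarrow> bool" where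
  "non_degenerate X Y Dxy \<longleftrightarrow> (\<forall>x\<in>X. \<forall>y\<in>Y. invertible (Dxy x y))"

definition c_image_X :: "'a set \<Rightarrow> ('a \<Rightarrow> 'b \<Rightarrow> 'd::real_normed_vector) \<Rightarrow> 'b \<Rightarrow> 'd set" where
  "c_image_X X Dyc y = (\<lambda>x. - Dyc x y) ` X"

definition c_image_Y :: "'b set \<Rightarrow> ('a \<Rightarrow> 'b \<Rightarrow> 'c::real_normed_vector) \<Rightarrow> 'a \<Rightarrow> 'c set" where
  "c_image_Y Y Dxc x = (\<lambda>y. - Dxc x y) ` Y"

definition X_c_convex :: "'a set \<Rightarrow> 'b set \<Rightarrow> ('a \<Rightarrow> 'b \<Rightarrow> 'd::real_normed_vector) \<Rightarrow> bool" where
  "X_c_convex X Y Dyc \<longleftrightarrow> (\<forall>y\<in>Y. convex (c_image_X X Dyc y))"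

definition Y_c_convex :: "'a set \<Rightarrow> 'b set \<Rightarrow> ('a \<Rightarrow> 'b \<Rightarrow> 'c::real_normed_vector) \<Rightarrow> bool" where
  "Y_c_convex X Y Dxc \<longleftrightarrow> (\<forall>x\<in>X. convex (c_image_Y Y Dxc x))"

definition c_exp :: "'a set \<Rightarrow> ('a \<Rightarrow> 'b \<Rightarrow> 'd::real_normed_vector) \<Rightarrow> 'b \<Rightarrow> 'd \<Rightarrow> 'a" where
  "c_exp X Dyc y = the_inv_into X (\<lambda>x. - Dyc x y)"

definition c_segment ::
  "'a set \<Rightarrow> ('a \<Rightarrow> 'b \<Rightarrow> 'd::real_normed_vector) \<Rightarrow> 'b \<Rightarrow> 'a \<Rightarrow> 'a \<Rightarrow> 'a set" where
  "c_segment X Dyc y x0 x1 =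
     {c_exp X Dyc y (t *\<^sub>R (- Dyc x1 y) + (1 - t) *\<^sub>R (- Dyc x0 y)) | t. t \<in> {0..1}}"

definition loeper ::
  "'a set \<Rightarrow> 'b set \<Rightarrow> ('a \<Rightarrow> 'b \<Rightarrow> real) \<Rightarrow> ('a \<Rightarrow> 'b \<Rightarrow> 'd::real_normed_vector) \<Rightarrow> bool" where
  "loeper X Y c Dyc \<longleftrightarrow>
     (\<forall>x0\<in>X. \<forall>x1\<in>X. \<forall>y0\<in>Y. \<forall>y\<in>Y. \<forall>xt\<in>c_segment X Dyc y0 x0 x1.
        - c xt y + c xt y0 \<le> max (- c x0 y + c x0 y0) (- c x1 y + c x1 y0))"

definition c_convex_fun :: "'a set \<Rightarrow> 'b set \<Rightarrow> ('a \<Rightarrow> 'b \<Rightarrow> real) \<Rightarrow> ('a \<Rightarrow> real) \<Rightarrow> bool" where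
  "c_convex_fun X Y c phi \<longleftrightarrow>
     (\<exists>psi :: 'b \<Rightarrow> ereal. (\<forall>y\<in>Y. psi y \<noteq> \<infinity>) \<and> (\<exists>y\<in>Y. psi y \<noteq> - \<infinity>) \<and>
        (\<forall>x\<in>X. ereal (phi x) = (SUP y\<in>Y. ereal (- c x y) + psi y)))"

definition c_chord ::
  "'b set \<Rightarrow> ('a \<Rightarrow> 'b \<Rightarrow> real) \<Rightarrow> 'a \<times> real \<Rightarrow> 'a \<times> real \<Rightarrow> 'a \<Rightarrow> ereal" where
  "c_chord Y c P0 P1 x =
     (SUP yh \<in> {(y, h). y \<in> Y \<and> - c (fst P0) y + h \<le> snd P0 \<and> - c (fst P1) y + h \<le> snd P1}.
        ereal (- c x (fst yh) + snd yh))"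

definition alt_c_convex_fun :: "'a set \<Rightarrow> 'b set \<Rightarrow> ('a \<Rightarrow> 'b \<Rightarrow> real) \<Rightarrow> ('a \<Rightarrow> real) \<Rightarrow> bool" where
  "alt_c_convex_fun X Y c phi \<longleftrightarrow>
     (\<forall>x0\<in>X. \<forall>x1\<in>X. \<forall>x\<in>X. ereal (phi x) \<le> c_chord Y c (x0, phi x0) (x1, phi x1) x)"

end

theory Submission
  imports Defs
begin

text \<open>By compactness, \<open>phi\<close> is \<open>c\<close>-convex iff every \<open>x\<close> admits a \<open>y\<close> with
  \<open>phi x + c x y \<le> phi x' + c x' y\<close> for all \<open>x'\<close>, and alternative \<open>c\<close>-convex iff such a \<open>y\<close> exists for
  every pair of points \<open>x'\<close>; so one implication always holds. Loeper's property is equivalent to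
  its dual, with \<open>X\<close> and \<open>Y\<close> exchanged. Under the dual property, the \<open>y\<close> that are admissible for one
  \<open>x'\<close> form a convex set in the coordinate \<open>- Dxc x y\<close>. If moreover \<open>phi\<close> is touched from above at
  \<open>x\<close> by a smooth function of gradient \<open>p\<close>, then pairing \<open>x'\<close> with points near \<open>x\<close> shows by
  separation that \<open>p\<close> lies in all these convex sets. Such points \<open>x\<close> are dense, and
  supports pass to limits. If the dual property fails, a local bump glued onto a maximum of
  \<open>c\<close>-affine functions gives the counterexample.\<close>

section \<open>Sequential limits on products and closures\<close>

lemma continuous_on_prod_LIMSEQ:
  fixes F :: "'a::metric_space \<Rightarrow> 'b::metric_space \<Rightarrow> 'c::topological_space"
  assumes "continuous_on (X \<times> Y) (\<lambda>(x, y). F x y)"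
    and "a \<longlonglongrightarrow> x" and "b \<longlonglongrightarrow> y"
    and "\<And>n. a n \<in> X" and "\<And>n. b n \<in> Y" and "x \<in> X" and "y \<in> Y"
  shows "(\<lambda>n. F (a n) (b n)) \<longlonglongrightarrow> F x y"
  using continuous_on_tendsto_compose[OF assms(1) tendsto_Pair[OF assms(2,3)]] assms(4-) by simp

lemma continuous_on_Times_swap:
  assumes "continuous_on (X \<times> Y) (\<lambda>(x, y). F x y)"
  shows "continuous_on (Y \<times> X) (\<lambda>(y, x). F x y)"
proof -
  have "continuous_on (Y \<times> X) (\<lambda>z. case prod.swap z of (x, y) \<Rightarrow> F x y)"
    by (rule continuous_on_compose2[OF assms]) (auto simp: continuous_on_swap)
  then show ?thesis by (simp add: case_prod_unfold)
qed

lemma mem_closure_LIMSEQ: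
  fixes x :: "'a::metric_space"
  assumes "X \<subseteq> closure S" "x \<in> X"
  obtains a where "\<And>n. a n \<in> S" "a \<longlonglongrightarrow> x"
  using assms by (meson closure_sequential subsetD)

text \<open>The point \<open>xt\<close> of the \<open>c\<close>-segment is given by its coordinate \<open>- Dyc xt y0\<close> instead of
  \<^const>\<open>c_exp\<close>; exchanging the roles of \<open>X\<close> and \<open>Y\<close> then yields the dual property.\<close>

definition loeper_on ::
  "'a set \<Rightarrow> 'a set \<Rightarrow> 'b set \<Rightarrow> ('a \<Rightarrow> 'b \<Rightarrow> real) \<Rightarrow> ('a \<Rightarrow> 'b \<Rightarrow> 'd::real_normed_vector) \<Rightarrow> bool" where
  "loeper_on X U V c Dyc \<longleftrightarrow>
     (\<forall>x0\<in>U. \<forall>x1\<in>U. \<forall>y0\<in>V. \<forall>y\<in>V. \<forall>t\<in>{0..1}. \<forall>xt\<in>X.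
        - Dyc xt y0 = t *\<^sub>R (- Dyc x1 y0) + (1 - t) *\<^sub>R (- Dyc x0 y0) \<longrightarrow>
        - c xt y + c xt y0 \<le> max (- c x0 y + c x0 y0) (- c x1 y + c x1 y0))"

lemma loeper_onD:
  assumes "loeper_on X U V c Dyc"
    and "x0 \<in> U" "x1 \<in> U" "y0 \<in> V" "y \<in> V" "0 \<le> t" "t \<le> 1" "xt \<in> X"
    and "- Dyc xt y0 = t *\<^sub>R (- Dyc x1 y0) + (1 - t) *\<^sub>R (- Dyc x0 y0)"
  shows "- c xt y + c xt y0 \<le> max (- c x0 y + c x0 y0) (- c x1 y + c x1 y0)"
  using assms unfolding loeper_on_def by (meson atLeastAtMost_iff)

lemma loeper_on_mono:
  assumes "loeper_on X U V c Dyc" "U' \<subseteq> U" "V' \<subseteq> V"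
  shows "loeper_on X U' V' c Dyc"
  using assms unfolding loeper_on_def by (meson subsetD)

section \<open>Bi-twisted costs and the coordinates \<open>- Dyc x y\<close> and
  \<open>- Dxc x y\<close>\<close>

locale bitwisted_cost =
  fixes X Y :: "(real^'n) set"
    and c :: "real^'n \<Rightarrow> real^'n \<Rightarrow> real"
    and Dxc Dyc :: "real^'n \<Rightarrow> real^'n \<Rightarrow> real^'n"
    and Dxy Dyx :: "real^'n \<Rightarrow> real^'n \<Rightarrow> real^'n^'n"
  assumes compact_X: "compact X" and compact_Y: "compact Y"
    and interior_X: "interior X \<noteq> {}" and interior_Y: "interior Y \<noteq> {}"
    and c_cont: "continuous_on (X \<times> Y) (\<lambda>(x, y). c x y)"
    and Dx: "x \<in> X \<Longrightarrow> y \<in> Y \<Longrightarrow> ((\<lambda>x'. c x' y) has_derivative (\<lambda>h. Dxc x y \<bullet> h)) (at x within X)"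
    and Dy: "x \<in> X \<Longrightarrow> y \<in> Y \<Longrightarrow> ((\<lambda>y'. c x y') has_derivative (\<lambda>k. Dyc x y \<bullet> k)) (at y within Y)"
    and Dxy: "x \<in> X \<Longrightarrow> y \<in> Y \<Longrightarrow> ((\<lambda>y'. Dxc x y') has_derivative (\<lambda>k. Dxy x y *v k)) (at y within Y)"
    and Dyx: "x \<in> X \<Longrightarrow> y \<in> Y \<Longrightarrow> ((\<lambda>x'. Dyc x' y) has_derivative (\<lambda>h. Dyx x y *v h)) (at x within X)"
    and Dxc_cont: "continuous_on (X \<times> Y) (\<lambda>(x, y). Dxc x y)"
    and Dyc_cont: "continuous_on (X \<times> Y) (\<lambda>(x, y). Dyc x y)"
    and inj_Dxc: "x \<in> X \<Longrightarrow> inj_on (\<lambda>y. - Dxc x y) Y"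
    and inj_Dyc: "y \<in> Y \<Longrightarrow> inj_on (\<lambda>x. - Dyc x y) X"
    and inv_Dxy: "x \<in> X \<Longrightarrow> y \<in> Y \<Longrightarrow> invertible (Dxy x y)"
    and inv_Dyx: "x \<in> X \<Longrightarrow> y \<in> Y \<Longrightarrow> invertible (Dyx x y)"
    and convex_X: "y \<in> Y \<Longrightarrow> convex ((\<lambda>x. - Dyc x y) ` X)"
    and convex_Y: "x \<in> X \<Longrightarrow> convex ((\<lambda>y. - Dxc x y) ` Y)"
begin

text \<open>The locale assumptions come in mirrored pairs, including invertibility of both mixed
  derivatives, so results about \<open>X\<close> transfer to \<open>Y\<close> through this
  lemma.\<close>

lemma swap:
  "bitwisted_cost Y X (\<lambda>y x. c x y) (\<lambda>y x. Dyc x y) (\<lambda>y x. Dxc x y) (\<lambda>y x. Dyx x y) (\<lambda>y x. Dxy x y)"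
proof
  fix x y assume "x \<in> X" "y \<in> Y"
  then show "((\<lambda>x'. c x' y) has_derivative (\<lambda>h. Dxc x y \<bullet> h)) (at x within X)"
    and "((\<lambda>y'. c x y') has_derivative (\<lambda>k. Dyc x y \<bullet> k)) (at y within Y)"
    and "((\<lambda>y'. Dxc x y') has_derivative (\<lambda>k. Dxy x y *v k)) (at y within Y)"
    and "((\<lambda>x'. Dyc x' y) has_derivative (\<lambda>h. Dyx x y *v h)) (at x within X)"
    and "invertible (Dxy x y)" "invertible (Dyx x y)"
    by (fact Dx Dy Dxy Dyx inv_Dxy inv_Dyx)+
qed (fact compact_X compact_Y interior_X interior_Y inj_Dxc inj_Dyc convex_X convex_Y
  continuous_on_Times_swap[OF c_cont] continuous_on_Times_swap[OF Dxc_cont]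
  continuous_on_Times_swap[OF Dyc_cont])+

lemma nonempty: "X \<noteq> {}" "Y \<noteq> {}"
  using interior_X interior_Y interior_subset by blast+

lemma Dyc_cont_section: "y \<in> Y \<Longrightarrow> continuous_on X (\<lambda>x. - Dyc x y)"
  using continuous_on_compose2[OF Dyc_cont, of X "\<lambda>x. (x, y)"]
  by (simp add: continuous_on_Pair continuous_on_minus image_subset_iff)

lemma c_cont_section: "y \<in> Y \<Longrightarrow> continuous_on X (\<lambda>x. c x y)"
  using continuous_on_compose2[OF c_cont, of X "\<lambda>x. (x, y)"] by (simp add: continuous_on_Pair image_subset_iff)

lemma continuous_exp:
  "y \<in> Y \<Longrightarrow> continuous_on ((\<lambda>x. - Dyc x y) ` X) (the_inv_into X (\<lambda>x. - Dyc x y))"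
  by (intro continuous_on_inv_into Dyc_cont_section compact_X inj_Dyc)

text \<open>Invariance of domain makes the coordinate map open on \<open>interior X\<close>. Its
  inverse is continuous because \<open>X\<close> is compact, so the same argument applies to it on
  the interior of the image.\<close>

lemma image_interior:
  assumes y: "y \<in> Y"
  shows "(\<lambda>x. - Dyc x y) ` interior X = interior ((\<lambda>x. - Dyc x y) ` X)"
proof
  let ?f = "\<lambda>x. - Dyc x y" and ?g = "the_inv_into X (\<lambda>x. - Dyc x y)"
  have "open (?f ` interior X)"
    by (intro invariance_of_domain continuous_on_subset[OF Dyc_cont_section[OF y]]
        inj_on_subset[OF inj_Dyc[OF y]] interior_subset open_interior)
  then show "?f ` interior X \<subseteq> interior (?f ` X)"
    by (intro interior_maximal image_mono interior_subset)
  have "open (?g ` interior (?f ` X))"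
    by (intro invariance_of_domain continuous_on_subset[OF continuous_exp[OF y]]
        inj_on_subset[OF inj_on_the_inv_into[OF inj_Dyc[OF y]]] interior_subset open_interior)
  moreover have "?g ` interior (?f ` X) \<subseteq> X"
    using interior_subset the_inv_into_into[OF inj_Dyc[OF y], of _ X] by blast
  ultimately have "?g ` interior (?f ` X) \<subseteq> interior X"
    by (rule interior_maximal[rotated])
  moreover have "p = ?f (?g p)" if "p \<in> interior (?f ` X)" for p
    using f_the_inv_into_f[OF inj_Dyc[OF y] subsetD[OF interior_subset that]] by simp
  ultimately show "interior (?f ` X) \<subseteq> ?f ` interior X"
    by blast
qed

text \<open>In coordinates \<open>X\<close> becomes a compact convex set with nonempty interior,
  hence the closure of its interior; the continuous inverse carries this back to
  \<open>X\<close>.\<close>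

lemma X_subset_closure_interior: "X \<subseteq> closure (interior X)"
proof
  fix x assume x: "x \<in> X"
  obtain y where y: "y \<in> Y" using nonempty by blast
  let ?f = "\<lambda>x. - Dyc x y" and ?g = "the_inv_into X (\<lambda>x. - Dyc x y)"
  have "closed (?f ` X)"
    by (intro compact_imp_closed compact_continuous_image Dyc_cont_section y compact_X)
  moreover have "interior (?f ` X) \<noteq> {}"
    using image_interior[OF y] interior_X by auto
  ultimately have cl: "closure (?f ` interior X) = ?f ` X"
    using convex_closure_interior[OF convex_X[OF y]] image_interior[OF y] by simp
  have g_f: "?g (?f a) = a" if "a \<in> interior X" for a
    by (intro the_inv_into_f_f inj_Dyc y subsetD[OF interior_subset that])
  have "?g ` closure (?f ` interior X) \<subseteq> closure (interior X)"
  proof (rule image_closure_subset)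
    show "continuous_on (closure (?f ` interior X)) ?g"
      unfolding cl by (rule continuous_exp[OF y])
    show "?g ` ?f ` interior X \<subseteq> closure (interior X)"
      unfolding image_subset_iff ball_simps using g_f closure_subset[of "interior X"] by auto
  qed simp
  then have "?g (?f x) \<in> closure (interior X)" using x cl by blast
  then show "x \<in> closure (interior X)" by (simp add: the_inv_into_f_f[OF inj_Dyc[OF y] x])
qed

lemma Y_subset_closure_interior: "Y \<subseteq> closure (interior Y)"
  by (rule bitwisted_cost.X_subset_closure_interior[OF swap])

text \<open>The interior of the convex coordinate image is convex, and \<open>image_interior\<close>
  identifies it with the image of \<open>interior X\<close>.\<close>

lemma segment_in_interior:
  assumes y: "y \<in> Y" and x: "x0 \<in> interior X" "x1 \<in> interior X" "xt \<in> X" and t: "0 \<le> t" "t \<le> 1"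
    and eq: "- Dyc xt y = t *\<^sub>R (- Dyc x1 y) + (1 - t) *\<^sub>R (- Dyc x0 y)"
  shows "xt \<in> interior X"
proof -
  have "t *\<^sub>R (- Dyc x1 y) + (1 - t) *\<^sub>R (- Dyc x0 y) \<in> interior ((\<lambda>x. - Dyc x y) ` X)"
    using convex_interior[OF convex_X[OF y]] x t
    unfolding image_interior[OF y, symmetric] by (intro convexD) auto
  then have "- Dyc xt y \<in> (\<lambda>x. - Dyc x y) ` interior X"
    using eq image_interior[OF y] by simp
  then obtain z where z: "z \<in> interior X" "- Dyc xt y = - Dyc z y" by blast
  then have "xt = z"
    using inj_onD[OF inj_Dyc[OF y] z(2)] x(3) interior_subset by blast
  then show ?thesis using z by simp
qed

lemma segment_point:
  assumes y: "y \<in> Y" and x: "x0 \<in> X" "x1 \<in> X" and t: "0 \<le> t" "t \<le> 1"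
  obtains xt where "xt \<in> X" "- Dyc xt y = t *\<^sub>R (- Dyc x1 y) + (1 - t) *\<^sub>R (- Dyc x0 y)"
proof -
  have "t *\<^sub>R (- Dyc x1 y) + (1 - t) *\<^sub>R (- Dyc x0 y) \<in> (\<lambda>x. - Dyc x y) ` X"
    by (rule convexD[OF convex_X[OF y]]) (use x t in auto)
  then show ?thesis by (elim imageE) (rule that, simp_all)
qed

lemma loeper_iff: "loeper X Y c Dyc \<longleftrightarrow> loeper_on X X Y c Dyc"
proof -
  have seg: "xt \<in> c_segment X Dyc y x0 x1 \<longleftrightarrow>
      xt \<in> X \<and> (\<exists>t\<in>{0..1}. - Dyc xt y = t *\<^sub>R (- Dyc x1 y) + (1 - t) *\<^sub>R (- Dyc x0 y))"
    if y: "y \<in> Y" and x: "x0 \<in> X" "x1 \<in> X" for x0 x1 y xt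
  proof
    assume "xt \<in> c_segment X Dyc y x0 x1"
    then obtain t where t: "t \<in> {0..1}" and
      xt: "xt = the_inv_into X (\<lambda>x. - Dyc x y) (t *\<^sub>R (- Dyc x1 y) + (1 - t) *\<^sub>R (- Dyc x0 y))"
      unfolding c_segment_def c_exp_def by blast
    obtain z where z: "z \<in> X" "- Dyc z y = t *\<^sub>R (- Dyc x1 y) + (1 - t) *\<^sub>R (- Dyc x0 y)"
      using segment_point[OF y x] t by (metis atLeastAtMost_iff)
    have "xt = z"
      unfolding xt z(2)[symmetric] by (rule the_inv_into_f_f[OF inj_Dyc[OF y] z(1)])
    then show "xt \<in> X \<and> (\<exists>t\<in>{0..1}. - Dyc xt y = t *\<^sub>R (- Dyc x1 y) + (1 - t) *\<^sub>R (- Dyc x0 y))"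
      using z t by blast
  next
    assume "xt \<in> X \<and> (\<exists>t\<in>{0..1}. - Dyc xt y = t *\<^sub>R (- Dyc x1 y) + (1 - t) *\<^sub>R (- Dyc x0 y))"
    then obtain t where t: "xt \<in> X" "t \<in> {0..1}"
      "- Dyc xt y = t *\<^sub>R (- Dyc x1 y) + (1 - t) *\<^sub>R (- Dyc x0 y)" by blast
    then show "xt \<in> c_segment X Dyc y x0 x1"
      unfolding c_segment_def c_exp_def
      using the_inv_into_f_f[OF inj_Dyc[OF y] t(1)] by auto
  qed
  show ?thesis
    unfolding loeper_def loeper_on_def
  proof (intro ball_cong refl, goal_cases)
    case (1 x0 x1 y0 y)
    then show ?case using seg[OF 1(3,1,2)] by blast
  qed
qed

text \<open>Approximate the four given points by interior ones and take the corresponding segment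
  points. A cluster point of these has the coordinate of \<open>xt\<close>, so it equals
  \<open>xt\<close> by injectivity, and the inequality passes to the limit.\<close>

lemma loeper_on_interior_imp:
  assumes L: "loeper_on X (interior X) (interior Y) c Dyc"
  shows "loeper_on X X Y c Dyc"
  unfolding loeper_on_def
proof (intro ballI impI)
  fix x0 x1 y0 y xt and t :: real
  assume x: "x0 \<in> X" "x1 \<in> X" and y: "y0 \<in> Y" "y \<in> Y" and t: "t \<in> {0..1}" and xt: "xt \<in> X"
    and eq: "- Dyc xt y0 = t *\<^sub>R (- Dyc x1 y0) + (1 - t) *\<^sub>R (- Dyc x0 y0)"
  note iX = subsetD[OF interior_subset[of X]] and iY = subsetD[OF interior_subset[of Y]]
  obtain a0 where a0: "\<And>n. a0 n \<in> interior X" "a0 \<longlonglongrightarrow> x0"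
    by (rule mem_closure_LIMSEQ[OF X_subset_closure_interior x(1)]) blast
  obtain a1 where a1: "\<And>n. a1 n \<in> interior X" "a1 \<longlonglongrightarrow> x1"
    by (rule mem_closure_LIMSEQ[OF X_subset_closure_interior x(2)]) blast
  obtain b0 where b0: "\<And>n. b0 n \<in> interior Y" "b0 \<longlonglongrightarrow> y0"
    by (rule mem_closure_LIMSEQ[OF Y_subset_closure_interior y(1)]) blast
  obtain b where b: "\<And>n. b n \<in> interior Y" "b \<longlonglongrightarrow> y"
    by (rule mem_closure_LIMSEQ[OF Y_subset_closure_interior y(2)]) blast
  have "\<exists>z\<in>X. - Dyc z (b0 n) = t *\<^sub>R (- Dyc (a1 n) (b0 n)) + (1 - t) *\<^sub>R (- Dyc (a0 n) (b0 n))" for n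
    using segment_point[OF iY[OF b0(1)] iX[OF a0(1)] iX[OF a1(1)]] t by (metis atLeastAtMost_iff)
  then obtain z where z: "\<And>n. z n \<in> X"
    "\<And>n. - Dyc (z n) (b0 n) = t *\<^sub>R (- Dyc (a1 n) (b0 n)) + (1 - t) *\<^sub>R (- Dyc (a0 n) (b0 n))"
    by metis
  obtain l r where l: "l \<in> X" and r: "strict_mono (r::nat \<Rightarrow> nat)" and zl: "(z \<circ> r) \<longlonglongrightarrow> l"
    using compact_X z(1) unfolding compact_def by metis
  note sub = LIMSEQ_subseq_LIMSEQ[OF _ r]
  note lims = zl sub[OF a0(2)] sub[OF a1(2)] sub[OF b0(2)] sub[OF b(2)]
  have lim: "(\<lambda>n. F ((u \<circ> r) n) ((v \<circ> r) n)) \<longlonglongrightarrow> F p q"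
    if "continuous_on (X \<times> Y) (\<lambda>(x, y). F x y)"
      "(u \<circ> r) \<longlonglongrightarrow> p" "(v \<circ> r) \<longlonglongrightarrow> q" "\<And>n. u n \<in> X" "\<And>n. v n \<in> Y" "p \<in> X" "q \<in> Y"
    for F :: "_ \<Rightarrow> _ \<Rightarrow> 'q::topological_space" and u v p q
    using continuous_on_prod_LIMSEQ[OF that(1-3)] that(4-) by simp
  have "(\<lambda>n. - Dyc ((z \<circ> r) n) ((b0 \<circ> r) n)) \<longlonglongrightarrow> - Dyc l y0"
    by (intro tendsto_minus lim[OF Dyc_cont] lims z iY b0 l y)
  moreover have "(\<lambda>n. t *\<^sub>R (- Dyc ((a1 \<circ> r) n) ((b0 \<circ> r) n)) + (1 - t) *\<^sub>R (- Dyc ((a0 \<circ> r) n) ((b0 \<circ> r) n)))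
      \<longlonglongrightarrow> t *\<^sub>R (- Dyc x1 y0) + (1 - t) *\<^sub>R (- Dyc x0 y0)"
    by (intro tendsto_add tendsto_scaleR tendsto_const tendsto_minus lim[OF Dyc_cont] lims iX iY a0 a1 b0 x y)
  ultimately have "- Dyc l y0 = - Dyc xt y0"
    using LIMSEQ_unique by (simp add: z(2) eq)
  then have [simp]: "l = xt"
    using inj_onD[OF inj_Dyc[OF y(1)]] l xt by blast
  have key: "- c (z n) (b n) + c (z n) (b0 n)
      \<le> max (- c (a0 n) (b n) + c (a0 n) (b0 n)) (- c (a1 n) (b n) + c (a1 n) (b0 n))" for n
    using t by (intro loeper_onD[OF L a0(1)[of n] a1(1)[of n] b0(1)[of n] b(1)[of n] _ _ z(1)[of n] z(2)[of n]])
      simp_all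
  have "(\<lambda>n. - c ((z \<circ> r) n) ((b \<circ> r) n) + c ((z \<circ> r) n) ((b0 \<circ> r) n)) \<longlonglongrightarrow> - c l y + c l y0"
    by (intro tendsto_add tendsto_minus lim[OF c_cont] lims z iY b0 b l y)
  moreover have "(\<lambda>n. max (- c ((a0 \<circ> r) n) ((b \<circ> r) n) + c ((a0 \<circ> r) n) ((b0 \<circ> r) n))
      (- c ((a1 \<circ> r) n) ((b \<circ> r) n) + c ((a1 \<circ> r) n) ((b0 \<circ> r) n)))
      \<longlonglongrightarrow> max (- c x0 y + c x0 y0) (- c x1 y + c x1 y0)"
    by (intro tendsto_max tendsto_add tendsto_minus lim[OF c_cont] lims iX iY a0 a1 b0 b x y)
  ultimately have "- c l y + c l y0 \<le> max (- c x0 y + c x0 y0) (- c x1 y + c x1 y0)"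
  proof (rule LIMSEQ_le)
    show "\<exists>N. \<forall>n\<ge>N. - c ((z \<circ> r) n) ((b \<circ> r) n) + c ((z \<circ> r) n) ((b0 \<circ> r) n)
      \<le> max (- c ((a0 \<circ> r) n) ((b \<circ> r) n) + c ((a0 \<circ> r) n) ((b0 \<circ> r) n))
          (- c ((a1 \<circ> r) n) ((b \<circ> r) n) + c ((a1 \<circ> r) n) ((b0 \<circ> r) n))"
      using key by simp
  qed
  then show "- c xt y + c xt y0 \<le> max (- c x0 y + c x0 y0) (- c x1 y + c x1 y0)" by simp
qed

subsection \<open>Duality of Loeper's property\<close>

text \<open>If the dual property fails at \<open>xs\<close>, both functions \<open>G y0\<close>, \<open>G y1\<close> below are smaller at \<open>xh\<close>, hence
  near \<open>xh\<close>, than at \<open>xs\<close>. Loeper's property keeps them below that value along \<open>c\<close>-segments from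
  \<open>xs\<close>, so their derivatives at \<open>xs\<close> are nonpositive in an open set of directions. As these
  derivatives are multiples of one covector \<open>\<delta>\<close> with opposite signs, \<open>\<delta> = 0\<close>.\<close>

lemma loeper_on_interior_swap:
  assumes L: "loeper_on X (interior X) (interior Y) c Dyc"
  shows "loeper_on Y (interior Y) (interior X) (\<lambda>y x. c x y) (\<lambda>y x. Dxc x y)"
  unfolding loeper_on_def
proof (intro ballI impI, rule ccontr)
  fix y0 y1 xs xh yt and t :: real
  assume y: "y0 \<in> interior Y" "y1 \<in> interior Y" and x: "xs \<in> interior X" "xh \<in> interior X"
    and t: "t \<in> {0..1}" and yt: "yt \<in> Y"
    and eq: "- Dxc xs yt = t *\<^sub>R (- Dxc xs y1) + (1 - t) *\<^sub>R (- Dxc xs y0)"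
    and neg: "\<not> - c xh yt + c xs yt \<le> max (- c xh y0 + c xs y0) (- c xh y1 + c xs y1)"
  note iX = subsetD[OF interior_subset[of X]] and iY = subsetD[OF interior_subset[of Y]]
  have yt_int: "yt \<in> interior Y"
    using bitwisted_cost.segment_in_interior[OF swap iX[OF x(1)] y yt _ _ eq] t by simp
  \<comment> \<open>In the chart \<open>f\<close> the \<open>c\<close>-segments with respect to
    \<open>yt\<close> are straight segments of the convex set \<open>K\<close>; \<open>g\<close> is
    the inverse chart.\<close>
  define f where "f = (\<lambda>x. - Dyc x yt)"
  define g where "g = the_inv_into X f"
  define K where "K = f ` X"
  define G where "G = (\<lambda>y x. - c x y + c x yt)"
  have K_int: "interior K = f ` interior X"
    using image_interior[OF yt] by (simp add: K_def f_def)
  have f_inj: "inj_on f X"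
    using inj_Dyc[OF yt] by (simp add: f_def)
  have gf: "g (f z) = z" if "z \<in> X" for z
    using the_inv_into_f_f[OF f_inj that] by (simp add: g_def)
  have fg: "f (g p) = p" if "p \<in> K" for p
    using gf that by (auto simp: K_def)
  have g_int: "g p \<in> interior X" if "p \<in> interior K" for p
    using that gf iX by (auto simp: K_int)
  have g_in: "g p \<in> X" if "p \<in> K" for p
    using that gf by (auto simp: K_def)
  have g_cont: "continuous_on K g"
    using continuous_exp[OF yt] by (simp add: K_def g_def f_def)
  have K_convex: "convex K"
    using convex_X[OF yt] by (simp add: K_def f_def)
  obtain A where A: "A ** Dyx xs yt = mat 1"
    using inv_Dyx[OF iX[OF x(1)] yt] invertible_def by blast
  define f' where "f' = (\<lambda>h. - (Dyx xs yt *v h))"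
  define g' where "g' = (\<lambda>v. - (A *v v))"
  have g'f': "g' (f' v) = v" for v
    by (simp add: g'_def f'_def matrix_vector_mul_assoc A linear_neg[OF matrix_vector_mul_linear])
  have g'_linear: "bounded_linear g'"
    unfolding g'_def by (rule bounded_linear_minus[OF matrix_vector_mul_bounded_linear])
  have at_xs: "at xs within X = at xs"
    by (rule at_within_interior[OF x(1)])
  \<comment> \<open>A continuous inverse is differentiable at the image of a point where the
    derivative of \<open>f\<close> is invertible, so \<open>G z\<close> can be differentiated along
    segments starting at \<open>f xs\<close>.\<close>
  have g_deriv: "(g has_derivative g') (at (f xs))"
  proof (rule has_derivative_inverse_basic[where f = f and f' = f' and T = "interior K"])
    show "(f has_derivative f') (at (g (f xs)))"
      unfolding gf[OF iX[OF x(1)]] unfolding f_def f'_def at_xs[symmetric]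
      by (rule has_derivative_minus[OF Dyx[OF iX[OF x(1)] yt]])
    show "g' \<circ> f' = id"
      using g'f' by auto
    show "continuous (at (f xs)) g"
      by (rule continuous_on_interior[OF g_cont]) (simp add: K_int x(1))
    show "f xs \<in> interior K"
      using x K_int by auto
    show "f (g p) = p" if "p \<in> interior K" for p
      using fg that interior_subset by blast
  qed (auto simp: g'_linear)
  have c_deriv: "((\<lambda>x. c x z) has_derivative (\<lambda>h. Dxc xs z \<bullet> h)) (at xs)" if "z \<in> Y" for z
    unfolding at_xs[symmetric] by (rule Dx[OF iX[OF x(1)] that])
  have dir: "(Dxc xs yt - Dxc xs z) \<bullet> g' (p - f xs) \<le> 0"
    if z: "z \<in> interior Y" and p: "p \<in> interior K" and le: "G z (g p) \<le> G z xs" for z p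
  proof (rule ccontr)
    assume contra: "\<not> (Dxc xs yt - Dxc xs z) \<bullet> g' (p - f xs) \<le> 0"
    define h where "h s = G z (g (f xs + s *\<^sub>R (p - f xs)))" for s
    have p_in: "p \<in> K" "f xs \<in> K"
      using p x K_int interior_subset iX by (auto simp: K_def)
    have "(G z has_derivative (\<lambda>v. - (Dxc xs z \<bullet> v) + Dxc xs yt \<bullet> v)) (at xs)"
      unfolding G_def by (intro has_derivative_add has_derivative_minus c_deriv iY z yt)
    then have "((\<lambda>q. G z (g q)) has_derivative (\<lambda>v. - (Dxc xs z \<bullet> g' v) + Dxc xs yt \<bullet> g' v)) (at (f xs))"
      using has_derivative_compose[OF g_deriv, of "G z"] gf iX[OF x(1)] by simp
    moreover have "((\<lambda>s. f xs + s *\<^sub>R (p - f xs)) has_derivative (\<lambda>s. s *\<^sub>R (p - f xs))) (at 0)"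
      by (auto intro!: derivative_eq_intros)
    ultimately have "(h has_derivative (\<lambda>s. - (Dxc xs z \<bullet> g' (s *\<^sub>R (p - f xs)))
        + Dxc xs yt \<bullet> g' (s *\<^sub>R (p - f xs)))) (at 0)"
      unfolding h_def
      using has_derivative_compose[of "\<lambda>s. f xs + s *\<^sub>R (p - f xs)" _ 0 UNIV "\<lambda>q. G z (g q)"] by simp
    then have "(h has_real_derivative (Dxc xs yt - Dxc xs z) \<bullet> g' (p - f xs)) (at 0)"
      unfolding has_field_derivative_def
      by (rule has_derivative_eq_rhs)
        (auto simp: linear_simps[OF g'_linear] inner_diff_left algebra_simps)
    then obtain d where d: "d > 0" "\<And>s. 0 < s \<Longrightarrow> s < d \<Longrightarrow> h 0 < h s"
      using DERIV_pos_inc_right contra by (metis add_0 not_le)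
    define s where "s = min (d / 2) 1"
    have s: "0 < s" "s < d" "s \<le> 1"
      using d by (auto simp: s_def)
    have line: "f xs + s *\<^sub>R (p - f xs) = s *\<^sub>R p + (1 - s) *\<^sub>R f xs"
      by (simp add: algebra_simps)
    have line_K: "f xs + s *\<^sub>R (p - f xs) \<in> K"
      unfolding line by (rule convexD[OF K_convex]) (use s p_in in auto)
    \<comment> \<open>By \<open>le\<close> this maximum is the value at the starting point
      \<open>xs\<close>, which excludes the initial increase of \<open>h\<close>.\<close>
    have "h s \<le> max (G z xs) (G z (g p))"
      unfolding h_def G_def
    proof (rule loeper_onD[OF L])
      show "- Dyc (g (f xs + s *\<^sub>R (p - f xs))) yt = s *\<^sub>R (- Dyc (g p) yt) + (1 - s) *\<^sub>R (- Dyc xs yt)"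
        using fg[OF line_K] fg[OF p_in(1)] line by (simp add: f_def)
    qed (use x g_int p yt_int z s g_in line_K in auto)
    also have "\<dots> = h 0"
      using le gf iX[OF x(1)] by (simp add: h_def)
    finally show False
      using d(2)[OF s(1,2)] by simp
  qed
  define W where "W z = interior K \<inter> (\<lambda>p. G z (g p)) -` {..<G z xs}" for z
  have W_open: "open (W z)" if "z \<in> Y" for z
    unfolding W_def
  proof (rule continuous_open_preimage)
    have "continuous_on (interior K) (\<lambda>p. c (g p) z)" if "z \<in> Y" for z
      by (rule continuous_on_compose2[OF c_cont_section[OF that]])
        (use g_cont g_in interior_subset continuous_on_subset in \<open>blast+\<close>)
    then show "continuous_on (interior K) (\<lambda>p. G z (g p))"
      unfolding G_def using that yt by (intro continuous_intros) auto
  qed auto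
  have "open (W y0 \<inter> W y1)"
    using W_open y iY by blast
  moreover have "f xh \<in> W y0 \<inter> W y1"
    using neg x K_int gf iX by (auto simp: W_def G_def)
  ultimately obtain \<rho> where \<rho>: "\<rho> > 0" "ball (f xh) \<rho> \<subseteq> W y0 \<inter> W y1"
    using open_contains_ball by blast
  define \<delta> where "\<delta> = Dxc xs y0 - Dxc xs y1"
  have D0: "Dxc xs yt - Dxc xs y0 = - (t *\<^sub>R \<delta>)"
    using eq by (simp add: \<delta>_def algebra_simps minus_equation_iff[of "Dxc xs yt"])
  have D1: "Dxc xs yt - Dxc xs y1 = (1 - t) *\<^sub>R \<delta>"
    using eq by (simp add: \<delta>_def algebra_simps minus_equation_iff[of "Dxc xs yt"])
  have ne: "yt \<noteq> y0" "yt \<noteq> y1"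
    using neg by auto
  have Dxc_inj: "u = v" if "Dxc xs u = Dxc xs v" "u \<in> Y" "v \<in> Y" for u v
    using inj_onD[OF inj_Dxc[OF iX[OF x(1)]]] that by auto
  \<comment> \<open>For \<open>t = 0\<close> or \<open>t = 1\<close> the twist would identify
    \<open>yt\<close> with \<open>y0\<close> or \<open>y1\<close>.\<close>
  have t': "0 < t" "t < 1"
    using D0 D1 t ne Dxc_inj[OF _ yt iY] y by (auto simp: less_le)
  have ortho: "\<delta> \<bullet> g' (p - f xs) = 0" if "p \<in> ball (f xh) \<rho>" for p
  proof -
    have "p \<in> W y0" "p \<in> W y1"
      using \<rho> that by auto
    then have "(Dxc xs yt - Dxc xs y0) \<bullet> g' (p - f xs) \<le> 0" "(Dxc xs yt - Dxc xs y1) \<bullet> g' (p - f xs) \<le> 0"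
      using dir y by (auto simp: W_def)
    then have "t * (\<delta> \<bullet> g' (p - f xs)) \<ge> 0" "(1 - t) * (\<delta> \<bullet> g' (p - f xs)) \<le> 0"
      unfolding D0 D1 by auto
    then show ?thesis
      using t' by (simp add: zero_le_mult_iff mult_le_0_iff)
  qed
  \<comment> \<open>Small enough to keep the displacement
    \<open>\<kappa> *\<^sub>R f' \<delta>\<close> inside the ball. Since \<open>g'\<close> inverts
    \<open>f'\<close>, comparing \<open>ortho\<close> at the centre and at the displaced point
    leaves \<open>\<kappa> * (\<delta> \<bullet> \<delta>) = 0\<close>.\<close>
  define \<kappa> where "\<kappa> = \<rho> / (2 * (norm (f' \<delta>) + 1))"
  have pos: "norm (f' \<delta>) + 1 > 0"
    using norm_ge_zero[of "f' \<delta>"] by linarith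
  then have \<kappa>: "\<kappa> > 0"
    using \<rho> by (simp add: \<kappa>_def)
  have "\<kappa> * norm (f' \<delta>) < \<kappa> * (norm (f' \<delta>) + 1)"
    using \<kappa> by simp
  also have "\<dots> = \<rho> / 2"
    unfolding \<kappa>_def using pos by (simp add: field_simps)
  also have "\<dots> < \<rho>"
    using \<rho> by simp
  finally have "\<kappa> * norm (f' \<delta>) < \<rho>" .
  then have "f xh + \<kappa> *\<^sub>R f' \<delta> \<in> ball (f xh) \<rho>"
    using \<kappa> by (simp add: dist_norm)
  from ortho[OF this] have "\<delta> \<bullet> g' (f xh - f xs + \<kappa> *\<^sub>R f' \<delta>) = 0"
    by (simp add: algebra_simps)
  moreover have "\<delta> \<bullet> g' (f xh - f xs) = 0"
    using ortho[of "f xh"] \<rho> by simp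
  ultimately have "\<kappa> * (\<delta> \<bullet> \<delta>) = 0"
    by (simp only: linear_simps[OF g'_linear] g'f' inner_add_right inner_scaleR_right)
  then have "\<delta> = 0"
    using \<kappa> by simp
  then have "Dxc xs yt = Dxc xs y0"
    using D0 by simp
  then show False
    using Dxc_inj yt iY y(1) ne by blast
qed

lemma loeper_on_interior_dual_iff:
  "loeper_on X (interior X) (interior Y) c Dyc \<longleftrightarrow>
   loeper_on Y (interior Y) (interior X) (\<lambda>y x. c x y) (\<lambda>y x. Dxc x y)"
  using loeper_on_interior_swap bitwisted_cost.loeper_on_interior_swap[OF swap] by blast

section \<open>Estimates for the cost that are uniform in the second variable\<close>

text \<open>Uniform continuity of \<open>Dxc\<close> on the compact product gives one radius for all
  \<open>y\<close> on which \<open>Dxc\<close> varies by less than \<open>e\<close>; the mean value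
  inequality then applies to the cost minus its linear part at \<open>x0\<close>.\<close>

lemma gradient_estimate:
  assumes x0: "x0 \<in> interior X" and e: "e > 0"
  obtains r where "r > 0" "cball x0 r \<subseteq> X"
    "\<And>x x' y. x \<in> cball x0 r \<Longrightarrow> x' \<in> cball x0 r \<Longrightarrow> y \<in> Y \<Longrightarrow>
      \<bar>c x y - c x' y - Dxc x0 y \<bullet> (x - x')\<bar> \<le> e * norm (x - x')"
proof -
  obtain r1 where r1: "r1 > 0" "cball x0 r1 \<subseteq> X"
    using x0 by (auto simp: mem_interior_cball)
  have "uniformly_continuous_on (X \<times> Y) (\<lambda>(x, y). Dxc x y)"
    by (intro compact_uniformly_continuous Dxc_cont compact_Times compact_X compact_Y)
  then obtain d where d: "d > 0"
    "\<And>z z'. z \<in> X \<times> Y \<Longrightarrow> z' \<in> X \<times> Y \<Longrightarrow> dist z' z < d \<Longrightarrow>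
      dist (case z' of (x, y) \<Rightarrow> Dxc x y) (case z of (x, y) \<Rightarrow> Dxc x y) < e"
    unfolding uniformly_continuous_on_def using e by metis
  define r where "r = min r1 (d / 2)"
  have r: "r > 0" "cball x0 r \<subseteq> X" "r < d"
    using r1 d(1) subset_trans[OF subset_cball[of r r1 x0]] by (auto simp: r_def)
  show thesis
  proof (rule that[OF r(1,2)])
    fix x x' y assume xx: "x \<in> cball x0 r" "x' \<in> cball x0 r" and y: "y \<in> Y"
    define F where "F z = c z y - Dxc x0 y \<bullet> z" for z
    have "norm (F x - F x') \<le> e * norm (x - x')"
    proof (rule differentiable_bound[OF convex_cball _ _ xx])
      fix z assume z: "z \<in> cball x0 r"
      show "(F has_derivative (\<lambda>h. Dxc z y \<bullet> h - Dxc x0 y \<bullet> h)) (at z within cball x0 r)"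
        unfolding F_def
        by (intro has_derivative_diff has_derivative_subset[OF Dx r(2)] derivative_intros)
          (use z r(2) y in auto)
      have "x0 \<in> X" "z \<in> X"
        using x0 interior_subset z r(2) by blast+
      then have "dist (Dxc z y) (Dxc x0 y) < e"
        using d(2)[of "(x0, y)" "(z, y)"] z r(3) y by (simp add: dist_Pair_Pair dist_commute)
      then have n: "norm (Dxc z y - Dxc x0 y) \<le> e"
        by (simp add: dist_norm)
      show "onorm (\<lambda>h. Dxc z y \<bullet> h - Dxc x0 y \<bullet> h) \<le> e"
      proof (rule onorm_bound)
        fix h
        have "norm (Dxc z y \<bullet> h - Dxc x0 y \<bullet> h) \<le> norm (Dxc z y - Dxc x0 y) * norm h"
          using Cauchy_Schwarz_ineq2[of "Dxc z y - Dxc x0 y" h] by (simp add: inner_diff_left)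
        also have "\<dots> \<le> e * norm h"
          by (intro mult_right_mono n) simp
        finally show "norm (Dxc z y \<bullet> h - Dxc x0 y \<bullet> h) \<le> e * norm h" .
      qed (use e in simp)
    qed
    then show "\<bar>c x y - c x' y - Dxc x0 y \<bullet> (x - x')\<bar> \<le> e * norm (x - x')"
      by (simp add: F_def inner_diff_right algebra_simps)
  qed
qed

lemma c_equicontinuous:
  assumes e: "e > 0"
  obtains d where "d > 0"
    "\<And>x x' y. x \<in> X \<Longrightarrow> x' \<in> X \<Longrightarrow> y \<in> Y \<Longrightarrow> dist x x' < d \<Longrightarrow> \<bar>c x y - c x' y\<bar> < e"
proof -
  have "uniformly_continuous_on (X \<times> Y) (\<lambda>(x, y). c x y)"
    by (intro compact_uniformly_continuous c_cont compact_Times compact_X compact_Y)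
  then obtain d where d: "d > 0"
    "\<And>z z'. z \<in> X \<times> Y \<Longrightarrow> z' \<in> X \<times> Y \<Longrightarrow> dist z' z < d \<Longrightarrow>
      dist (case z' of (x, y) \<Rightarrow> c x y) (case z of (x, y) \<Rightarrow> c x y) < e"
    unfolding uniformly_continuous_on_def using e by metis
  show thesis
  proof (rule that[OF d(1)])
    fix x x' y assume "x \<in> X" "x' \<in> X" "y \<in> Y" "dist x x' < d"
    then show "\<bar>c x y - c x' y\<bar> < e"
      using d(2)[of "(x', y)" "(x, y)"] by (simp add: dist_Pair_Pair dist_real_def)
  qed
qed

subsection \<open>Supports of alternative c-convex functions\<close>

lemma c_cont_section_Y: "x \<in> X \<Longrightarrow> continuous_on Y (\<lambda>y. c x y)"
  by (rule bitwisted_cost.c_cont_section[OF swap])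

text \<open>For fixed \<open>y\<close> the best admissible height is
  \<open>min (u0 + c x0 y) (u1 + c x1 y)\<close>. The resulting value is continuous in
  \<open>y\<close>, so on compact \<open>Y\<close> the supremum is attained.\<close>

lemma c_chord_ge_iff:
  assumes x: "x0 \<in> X" "x1 \<in> X" "x \<in> X"
  shows "ereal u \<le> c_chord Y c (x0, u0) (x1, u1) x \<longleftrightarrow>
    (\<exists>y\<in>Y. u + c x y \<le> u0 + c x0 y \<and> u + c x y \<le> u1 + c x1 y)"
proof
  assume le: "ereal u \<le> c_chord Y c (x0, u0) (x1, u1) x"
  define m where "m y = min (u0 + c x0 y) (u1 + c x1 y) - c x y" for y
  have "continuous_on Y m"
    unfolding m_def by (intro continuous_intros c_cont_section_Y x)
  then obtain y where y: "y \<in> Y" "\<And>z. z \<in> Y \<Longrightarrow> m z \<le> m y"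
    using continuous_attains_sup[OF compact_Y nonempty(2)] by blast
  have "c_chord Y c (x0, u0) (x1, u1) x \<le> ereal (m y)"
    unfolding c_chord_def
  proof (rule SUP_least)
    fix zh assume "zh \<in> {(y, h). y \<in> Y \<and> - c (fst (x0, u0)) y + h \<le> snd (x0, u0) \<and>
      - c (fst (x1, u1)) y + h \<le> snd (x1, u1)}"
    then have "fst zh \<in> Y" "snd zh \<le> u0 + c x0 (fst zh)" "snd zh \<le> u1 + c x1 (fst zh)"
      by auto
    then have "- c x (fst zh) + snd zh \<le> m y"
      using y(2)[of "fst zh"] unfolding m_def[of "fst zh"] by linarith
    then show "ereal (- c x (fst zh) + snd zh) \<le> ereal (m y)"
      by simp
  qed
  then have "u \<le> m y"
    using le order_trans ereal_less_eq(3) by blast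
  then show "\<exists>y\<in>Y. u + c x y \<le> u0 + c x0 y \<and> u + c x y \<le> u1 + c x1 y"
    using y(1) by (intro bexI[of _ y]) (auto simp: m_def)
next
  assume "\<exists>y\<in>Y. u + c x y \<le> u0 + c x0 y \<and> u + c x y \<le> u1 + c x1 y"
  then obtain y where y: "y \<in> Y" "u + c x y \<le> u0 + c x0 y" "u + c x y \<le> u1 + c x1 y"
    by blast
  show "ereal u \<le> c_chord Y c (x0, u0) (x1, u1) x"
    unfolding c_chord_def by (rule SUP_upper2[of "(y, u + c x y)"]) (use y in auto)
qed

lemma alt_c_convex_fun_iff:
  "alt_c_convex_fun X Y c phi \<longleftrightarrow>
    (\<forall>x0\<in>X. \<forall>x1\<in>X. \<forall>x\<in>X. \<exists>y\<in>Y. phi x + c x y \<le> phi x0 + c x0 y \<and> phi x + c x y \<le> phi x1 + c x1 y)"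
  unfolding alt_c_convex_fun_def using c_chord_ge_iff by simp

lemma alt_c_convex_funD:
  assumes "alt_c_convex_fun X Y c phi" "x0 \<in> X" "x1 \<in> X" "x \<in> X"
  obtains y where "y \<in> Y" "phi x + c x y \<le> phi x0 + c x0 y" "phi x + c x y \<le> phi x1 + c x1 y"
  using assms unfolding alt_c_convex_fun_iff by blast

text \<open>Forwards, nearly optimal \<open>y\<close> are supports at \<open>x\<close> up to
  \<open>1 / Suc n\<close>, and a cluster point is an exact support. Backwards, a support at
  \<open>x\<close> shows that the supremum for the \<open>c\<close>-transform of \<open>phi\<close>
  is attained with value \<open>phi x\<close>.\<close>

lemma c_convex_fun_iff:
  "c_convex_fun X Y c phi \<longleftrightarrow>
    (\<forall>x\<in>X. \<exists>y\<in>Y. \<forall>x'\<in>X. phi x + c x y \<le> phi x' + c x' y)"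
proof
  assume "c_convex_fun X Y c phi"
  then obtain psi :: "real^'n \<Rightarrow> ereal" where psi: "\<And>y. y \<in> Y \<Longrightarrow> psi y \<noteq> \<infinity>"
    "\<And>x. x \<in> X \<Longrightarrow> ereal (phi x) = (SUP y\<in>Y. ereal (- c x y) + psi y)"
    unfolding c_convex_fun_def by blast
  show "\<forall>x\<in>X. \<exists>y\<in>Y. \<forall>x'\<in>X. phi x + c x y \<le> phi x' + c x' y"
  proof
    fix x assume x: "x \<in> X"
    have "\<exists>y\<in>Y. \<forall>x'\<in>X. phi x - 1 / real (Suc n) + c x y \<le> phi x' + c x' y" for n
    proof -
      have "ereal (phi x - 1 / real (Suc n)) < (SUP y\<in>Y. ereal (- c x y) + psi y)"
        unfolding psi(2)[OF x, symmetric] by simp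
      then obtain y where y: "y \<in> Y" "ereal (phi x - 1 / real (Suc n)) < ereal (- c x y) + psi y"
        unfolding less_SUP_iff by blast
      then obtain h where h: "psi y = ereal h"
        using psi(1)[OF y(1)] by (cases "psi y") auto
      have "phi x - 1 / real (Suc n) + c x y \<le> phi x' + c x' y" if x': "x' \<in> X" for x'
      proof -
        have "ereal (- c x' y) + psi y \<le> ereal (phi x')"
          unfolding psi(2)[OF x'] using y(1) by (rule SUP_upper)
        then show ?thesis
          using y(2) h by simp
      qed
      then show ?thesis using y(1) by blast
    qed
    then obtain y where y: "\<And>n. y n \<in> Y"
      "\<And>n x'. x' \<in> X \<Longrightarrow> phi x - 1 / real (Suc n) + c x (y n) \<le> phi x' + c x' (y n)"
      by metis
    obtain l r where l: "l \<in> Y" and r: "strict_mono (r::nat \<Rightarrow> nat)" and yl: "(y \<circ> r) \<longlonglongrightarrow> l"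
      using compact_Y y(1) unfolding compact_def by metis
    have lim: "(\<lambda>n. c x' (y (r n))) \<longlonglongrightarrow> c x' l" if "x' \<in> X" for x'
      using continuous_on_tendsto_compose[OF c_cont_section_Y[OF that] yl l] y(1) by simp
    have "(\<lambda>n. 1 / real (Suc (r n))) \<longlonglongrightarrow> 0"
      using LIMSEQ_subseq_LIMSEQ[OF LIMSEQ_Suc[OF lim_1_over_n] r] by (simp add: comp_def)
    then have "(\<lambda>n. phi x - 1 / real (Suc (r n)) + c x (y (r n))) \<longlonglongrightarrow> phi x - 0 + c x l"
      by (intro tendsto_intros lim x)
    moreover have "(\<lambda>n. phi x' + c x' (y (r n))) \<longlonglongrightarrow> phi x' + c x' l" if "x' \<in> X" for x'
      by (intro tendsto_intros lim that)
    ultimately have "phi x - 0 + c x l \<le> phi x' + c x' l" if "x' \<in> X" for x'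
      by (rule LIMSEQ_le) (use y(2) that in auto)
    then show "\<exists>y\<in>Y. \<forall>x'\<in>X. phi x + c x y \<le> phi x' + c x' y"
      using l by auto
  qed
next
  assume supp: "\<forall>x\<in>X. \<exists>y\<in>Y. \<forall>x'\<in>X. phi x + c x y \<le> phi x' + c x' y"
  \<comment> \<open>The \<open>c\<close>-transform of \<open>phi\<close>: the largest height for
    which the \<open>c\<close>-affine function of \<open>y\<close> stays below
    \<open>phi\<close>.\<close>
  define psi where "psi y = (INF x\<in>X. ereal (phi x + c x y))" for y
  have le: "psi y \<le> ereal (phi x + c x y)" if "x \<in> X" for x y
    unfolding psi_def using that by (rule INF_lower)
  have ge: "ereal u \<le> psi y" if "\<And>x. x \<in> X \<Longrightarrow> u \<le> phi x + c x y" for u y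
    unfolding psi_def by (rule INF_greatest) (use that in simp)
  obtain a where a: "a \<in> X" using nonempty by blast
  show "c_convex_fun X Y c phi"
    unfolding c_convex_fun_def
  proof (intro exI[of _ psi] conjI ballI)
    show "psi y \<noteq> \<infinity>" for y
      using le[OF a, of y] by auto
    obtain y where y: "y \<in> Y" "\<forall>x\<in>X. phi a + c a y \<le> phi x + c x y"
      using supp a by blast
    then have "ereal (phi a + c a y) \<le> psi y"
      by (intro ge) blast
    then show "\<exists>y\<in>Y. psi y \<noteq> - \<infinity>"
      using y(1) by (intro bexI[of _ y]) auto
    fix x assume x: "x \<in> X"
    show "ereal (phi x) = (SUP y\<in>Y. ereal (- c x y) + psi y)"
    proof (rule antisym)
      obtain y where y: "y \<in> Y" "\<forall>x'\<in>X. phi x + c x y \<le> phi x' + c x' y"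
        using supp x by blast
      then have "ereal (phi x + c x y) \<le> psi y"
        by (intro ge) blast
      then have "ereal (- c x y) + ereal (phi x + c x y) \<le> ereal (- c x y) + psi y"
        by (rule add_left_mono)
      then show "ereal (phi x) \<le> (SUP y\<in>Y. ereal (- c x y) + psi y)"
        by (intro SUP_upper2[OF y(1)]) simp
      show "(SUP y\<in>Y. ereal (- c x y) + psi y) \<le> ereal (phi x)"
      proof (rule SUP_least)
        fix y assume "y \<in> Y"
        have "ereal (- c x y) + psi y \<le> ereal (- c x y) + ereal (phi x + c x y)"
          by (rule add_left_mono[OF le[OF x]])
        then show "ereal (- c x y) + psi y \<le> ereal (phi x)" by simp
      qed
    qed
  qed
qed

lemma c_convex_imp_alt_c_convex: "c_convex_fun X Y c phi \<Longrightarrow> alt_c_convex_fun X Y c phi"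
  unfolding c_convex_fun_iff alt_c_convex_fun_iff by meson

text \<open>With both endpoints equal to \<open>v\<close>, the chord condition bounds
  \<open>phi u - phi v\<close> by \<open>c v y - c u y\<close> for some \<open>y\<close>, and
  \<open>c\<close> is equicontinuous in its first variable.\<close>

lemma alt_c_convex_continuous:
  assumes alt: "alt_c_convex_fun X Y c phi"
  shows "continuous_on X phi"
  unfolding continuous_on_iff
proof (intro ballI allI impI)
  fix x e assume x: "x \<in> X" and e: "(0::real) < e"
  obtain d where d: "d > 0"
    "\<And>x x' y. x \<in> X \<Longrightarrow> x' \<in> X \<Longrightarrow> y \<in> Y \<Longrightarrow> dist x x' < d \<Longrightarrow> \<bar>c x y - c x' y\<bar> < e"
    using c_equicontinuous[OF e] by blast
  have one: "phi u - phi v < e" if uv: "u \<in> X" "v \<in> X" "dist u v < d" for u v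
  proof -
    obtain y where "y \<in> Y" "phi u + c u y \<le> phi v + c v y"
      using alt_c_convex_funD[OF alt uv(2,2,1)] by blast
    then show ?thesis using d(2)[OF uv(1,2) _ uv(3), of y] by linarith
  qed
  show "\<exists>d>0. \<forall>x'\<in>X. dist x' x < d \<longrightarrow> dist (phi x') (phi x) < e"
  proof (intro exI[of _ d] conjI ballI impI d(1))
    fix x' assume "x' \<in> X" "dist x' x < d"
    then show "dist (phi x') (phi x) < e"
      using one[of x x'] one[of x' x] x by (simp add: dist_real_def dist_commute abs_less_iff)
  qed
qed

text \<open>Where \<open>phi\<close> is touched from above by a smooth function of gradient \<open>p\<close>, the set
  \<open>S x1\<close> of those \<open>y\<close> whose \<open>c\<close>-affine function through \<open>(xs, phi xs)\<close> stays below \<open>phi\<close> at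
  \<open>x1\<close> is convex in the coordinate \<open>- Dxc xs y\<close>. Testing the pair consisting of \<open>x1\<close> and a point
  close to \<open>xs\<close> shows that no hyperplane separates \<open>p\<close> from \<open>S x1\<close>, so the \<open>y\<close> with
  coordinate \<open>p\<close> lies in \<open>S x1\<close> for all \<open>x1\<close> at once.\<close>

lemma support_if_touched_from_above:
  assumes alt: "alt_c_convex_fun X Y c phi"
    and L: "loeper_on Y Y X (\<lambda>y x. c x y) (\<lambda>y x. Dxc x y)"
    and xs: "xs \<in> interior X" and r: "r > 0" and C: "C \<ge> 0"
    and above: "\<And>x. x \<in> X \<Longrightarrow> x \<in> cball xs r \<Longrightarrow>
      phi x \<le> phi xs + p \<bullet> (x - xs) + C * (norm (x - xs))\<^sup>2"
  shows "\<exists>y\<in>Y. \<forall>x\<in>X. phi xs + c xs y \<le> phi x + c x y"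
proof -
  have xsX: "xs \<in> X" using xs interior_subset by blast
  define S where "S x1 = {y \<in> Y. phi xs + c xs y \<le> phi x1 + c x1 y}" for x1
  have key: "p \<in> (\<lambda>y. - Dxc xs y) ` S x1" if x1: "x1 \<in> X" for x1
  proof (rule ccontr)
    let ?T = "(\<lambda>y. - Dxc xs y) ` S x1"
    assume p: "p \<notin> ?T"
    have "S x1 = Y \<inter> (\<lambda>y. c xs y - c x1 y) -` {..phi x1 - phi xs}"
      by (auto simp: S_def)
    moreover have "closed (Y \<inter> (\<lambda>y. c xs y - c x1 y) -` {..phi x1 - phi xs})"
      by (intro continuous_closed_preimage continuous_on_diff c_cont_section_Y xsX x1 closed_atMost
          compact_imp_closed[OF compact_Y])
    ultimately have "closed (S x1)" by simp
    then have "compact (S x1)"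
      using compact_Int_closed[OF compact_Y, of "S x1"] by (simp add: S_def Int_absorb1 Int_def)
    moreover have "continuous_on (S x1) (\<lambda>y. - Dxc xs y)"
      by (rule continuous_on_subset[OF bitwisted_cost.Dyc_cont_section[OF swap xsX]])
        (auto simp: S_def)
    ultimately have closed: "closed ?T"
      by (intro compact_imp_closed compact_continuous_image)
    have convex: "convex ?T"
    proof (rule convexI)
      fix q0 q1 and u v :: real
      assume q: "q0 \<in> ?T" "q1 \<in> ?T" and uv: "0 \<le> u" "0 \<le> v" "u + v = 1"
      then obtain y0 y1 where y: "y0 \<in> S x1" "y1 \<in> S x1" "q0 = - Dxc xs y0" "q1 = - Dxc xs y1"
        by auto
      then have Y: "y0 \<in> Y" "y1 \<in> Y" by (auto simp: S_def)
      have v: "v \<le> 1" and u: "u = 1 - v" using uv by auto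
      obtain yt where yt: "yt \<in> Y" "- Dxc xs yt = v *\<^sub>R (- Dxc xs y1) + (1 - v) *\<^sub>R (- Dxc xs y0)"
        using bitwisted_cost.segment_point[OF swap xsX Y uv(2) v] by blast
      have "- c x1 yt + c xs yt \<le> max (- c x1 y0 + c xs y0) (- c x1 y1 + c xs y1)"
        by (rule loeper_onD[OF L Y xsX x1 uv(2) v yt])
      then have "yt \<in> S x1"
        using y(1,2) yt(1) by (auto simp: S_def)
      moreover have "u *\<^sub>R q0 + v *\<^sub>R q1 = - Dxc xs yt"
        unfolding yt(2) y u by simp
      ultimately show "u *\<^sub>R q0 + v *\<^sub>R q1 \<in> ?T" by blast
    qed
    obtain a b where ab: "a \<bullet> p < b" "\<And>q. q \<in> ?T \<Longrightarrow> b < a \<bullet> q"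
      using separating_hyperplane_closed_point[OF convex closed p] by blast
    \<comment> \<open>The separation gap is spent in two halves: \<open>e\<close> limits the
      linearisation error of \<open>c\<close>, and \<open>\<tau>\<close> below limits the quadratic
      term and keeps \<open>x\<close> in both balls. Adding 1 to \<open>norm a\<close> in the
      denominators also covers \<open>a = 0\<close>, which can occur when \<open>?T\<close> is
      empty.\<close>
    define \<beta> where "\<beta> = b - a \<bullet> p"
    define e where "e = \<beta> / (2 * (norm a + 1))"
    have \<beta>: "\<beta> > 0" using ab by (simp add: \<beta>_def)
    have na: "norm a + 1 > 0" using norm_ge_zero[of a] by linarith
    have e: "e > 0" using \<beta> na by (simp add: e_def)
    have ea: "e * norm a \<le> \<beta> / 2"
    proof -
      have "e * norm a \<le> e * (norm a + 1)" using e by simp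
      also have "\<dots> = \<beta> / 2" using na by (simp add: e_def field_simps)
      finally show ?thesis .
    qed
    obtain r' where r': "r' > 0" "cball xs r' \<subseteq> X"
      "\<And>x x' y. x \<in> cball xs r' \<Longrightarrow> x' \<in> cball xs r' \<Longrightarrow> y \<in> Y \<Longrightarrow>
        \<bar>c x y - c x' y - Dxc xs y \<bullet> (x - x')\<bar> \<le> e * norm (x - x')"
      using gradient_estimate[OF xs e] by blast
    define M where "M = C * (norm a)\<^sup>2 + 1"
    have M: "M > 0" using C by (simp add: M_def add_nonneg_pos)
    define \<tau> where "\<tau> = min (min r r' / (norm a + 1)) (\<beta> / (2 * M))"
    have \<tau>: "\<tau> > 0" using r r'(1) na \<beta> M by (simp add: \<tau>_def)
    have "\<tau> * norm a \<le> \<tau> * (norm a + 1)" using \<tau> by simp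
    also have "\<dots> \<le> min r r'"
    proof -
      have "\<tau> \<le> min r r' / (norm a + 1)" by (simp add: \<tau>_def)
      then show ?thesis using na by (simp only: pos_le_divide_eq)
    qed
    finally have \<tau>r: "\<tau> * norm a \<le> min r r'" .
    have \<tau>C: "C * \<tau> * (norm a)\<^sup>2 \<le> \<beta> / 2"
    proof -
      have "\<tau> \<le> \<beta> / (2 * M)" by (simp add: \<tau>_def)
      then have "\<tau> * M \<le> \<beta> / 2" using M by (simp add: field_simps)
      moreover have "\<tau> * M = C * \<tau> * (norm a)\<^sup>2 + \<tau>" by (simp add: M_def algebra_simps)
      ultimately show ?thesis using \<tau> by linarith
    qed
    \<comment> \<open>The test point lies in the direction of the separating normal. The
      \<open>y\<close> given by the chord condition for \<open>x\<close> and \<open>x1\<close> is in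
      \<open>S x1\<close>, yet to first order at \<open>x\<close> its coordinate lies on the side of
      \<open>p\<close>.\<close>
    define x where "x = xs + \<tau> *\<^sub>R a"
    have x: "x \<in> cball xs r" "x \<in> cball xs r'" "xs \<in> cball xs r'" "x \<in> X"
      using \<tau> \<tau>r r' by (auto simp: x_def dist_norm subset_iff)
    obtain y where y: "y \<in> Y" "phi xs + c xs y \<le> phi x + c x y" "phi xs + c xs y \<le> phi x1 + c x1 y"
      by (rule alt_c_convex_funD[OF alt x(4) x1 xsX])
    then have "b < a \<bullet> (- Dxc xs y)"
      by (intro ab) (auto simp: S_def)
    then have "\<tau> * b < \<tau> * (a \<bullet> (- Dxc xs y))"
      using \<tau> by (rule mult_strict_left_mono)
    moreover have "c x y - c xs y - \<tau> * (Dxc xs y \<bullet> a) \<le> \<tau> * (e * norm a)"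
      using r'(3)[OF x(2,3) y(1)] \<tau> by (simp add: x_def algebra_simps)
    moreover have "phi x \<le> phi xs + \<tau> * (p \<bullet> a) + \<tau> * (C * \<tau> * (norm a)\<^sup>2)"
      using above[OF x(4,1)] \<tau> by (simp add: x_def power_mult_distrib power2_eq_square algebra_simps)
    moreover have "\<tau> * (e * norm a) \<le> \<tau> * (\<beta> / 2)" "\<tau> * (C * \<tau> * (norm a)\<^sup>2) \<le> \<tau> * (\<beta> / 2)"
      using ea \<tau>C \<tau> by (auto intro!: mult_left_mono)
    moreover have "\<tau> * b = \<tau> * \<beta> + \<tau> * (p \<bullet> a)"
      by (simp add: \<beta>_def algebra_simps inner_commute)
    moreover have "\<tau> * (a \<bullet> (- Dxc xs y)) = - (\<tau> * (Dxc xs y \<bullet> a))"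
      by (simp add: inner_commute)
    moreover have "\<tau> * (\<beta> / 2) + \<tau> * (\<beta> / 2) = \<tau> * \<beta>" by simp
    ultimately show False using y(2) by linarith
  qed
  \<comment> \<open>As \<open>S xs\<close> is all of \<open>Y\<close>, this merely provides a point
    of \<open>Y\<close> with coordinate \<open>p\<close>; injectivity identifies it with the points
    found for other \<open>x\<close>.\<close>
  obtain y where y: "y \<in> S xs" "p = - Dxc xs y"
    using key[OF xsX] by blast
  show ?thesis
  proof (intro bexI ballI)
    show "y \<in> Y" using y by (simp add: S_def)
    fix x assume "x \<in> X"
    then obtain z where z: "z \<in> S x" "p = - Dxc xs z"
      using key by blast
    then have "z = y"
      using inj_onD[OF inj_Dxc[OF xsX]] y by (auto simp: S_def)
    then show "phi xs + c xs y \<le> phi x + c x y"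
      using z by (simp add: S_def)
  qed
qed

text \<open>Maximising \<open>phi\<close> minus a steep paraboloid over a small ball gives a nearby
  point where \<open>phi\<close> is touched from above. Hence the set \<open>D\<close> of points
  with a support is dense, and compactness of \<open>Y\<close> extends supports to all of
  \<open>X\<close>.\<close>

lemma alt_c_convex_imp_c_convex:
  assumes alt: "alt_c_convex_fun X Y c phi"
    and L: "loeper_on Y Y X (\<lambda>y x. c x y) (\<lambda>y x. Dxc x y)"
  shows "c_convex_fun X Y c phi"
proof -
  define D where "D = {x \<in> X. \<exists>y\<in>Y. \<forall>x'\<in>X. phi x + c x y \<le> phi x' + c x' y}"
  have phi_cont: "continuous_on X phi"
    by (rule alt_c_convex_continuous[OF alt])
  obtain M where M: "\<And>x. x \<in> X \<Longrightarrow> \<bar>phi x\<bar> \<le> M"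
    using compact_imp_bounded[OF compact_continuous_image[OF phi_cont compact_X]]
    by (auto simp: bounded_iff)
  have dense: "\<exists>x\<in>D. dist x z < e" if z: "z \<in> interior X" and e: "e > 0" for z e
  proof -
    obtain r1 where r1: "r1 > 0" "cball z r1 \<subseteq> interior X"
      using z open_contains_cball[of "interior X"] by auto
    define r where "r = min r1 e"
    have r: "r > 0" "r \<le> e" "cball z r \<subseteq> interior X"
      using r1 e subset_trans[OF subset_cball[of r r1 z]] by (auto simp: r_def)
    have rX: "cball z r \<subseteq> X" using r(3) interior_subset by blast
    \<comment> \<open>On the sphere of radius \<open>r\<close> the paraboloid exceeds the
      oscillation bound \<open>2 * M\<close> of \<open>phi\<close>, so the maximiser is strictly
      inside the ball.\<close>
    define C where "C = (2 * M + 1) / r\<^sup>2"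
    have "z \<in> X" using z interior_subset by blast
    note zX = this
    then have M0: "M \<ge> 0" using M[of z] abs_ge_zero[of "phi z"] by linarith
    then have C: "C \<ge> 0" by (simp add: C_def)
    have ne: "cball z r \<noteq> {}" using r(1) by simp
    have "continuous_on (cball z r) (\<lambda>x. phi x - C * (norm (x - z))\<^sup>2)"
      by (intro continuous_intros continuous_on_subset[OF phi_cont rX])
    then obtain xs where xs: "xs \<in> cball z r"
      "\<And>x. x \<in> cball z r \<Longrightarrow> phi x - C * (norm (x - z))\<^sup>2 \<le> phi xs - C * (norm (xs - z))\<^sup>2"
      using continuous_attains_sup[OF compact_cball ne] by blast
    have "norm (xs - z) < r"
    proof (rule ccontr)
      assume "\<not> norm (xs - z) < r"
      then have "r\<^sup>2 \<le> (norm (xs - z))\<^sup>2" using r by (intro power_mono) auto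
      then have "C * r\<^sup>2 \<le> C * (norm (xs - z))\<^sup>2" using C by (rule mult_left_mono)
      moreover have "C * r\<^sup>2 = 2 * M + 1" using r by (simp add: C_def)
      moreover have "phi z \<le> phi xs - C * (norm (xs - z))\<^sup>2" using xs(2)[of z] r by simp
      moreover have "\<bar>phi z\<bar> \<le> M" "\<bar>phi xs\<bar> \<le> M" using M zX xs(1) rX by auto
      ultimately show False by linarith
    qed
    then have near: "dist xs z < r" by (simp add: dist_norm)
    have "\<exists>y\<in>Y. \<forall>x\<in>X. phi xs + c xs y \<le> phi x + c x y"
    proof (rule support_if_touched_from_above[OF alt L])
      show "xs \<in> interior X" using xs(1) r by blast
      show "0 < r - dist xs z" using near by simp
      show "0 \<le> C" by (rule C)
      fix x assume "x \<in> X" "x \<in> cball xs (r - dist xs z)"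
      then have "x \<in> cball z r"
        using dist_triangle[of z x xs] by (simp add: dist_commute)
      then have "phi x \<le> phi xs - C * (norm (xs - z))\<^sup>2 + C * (norm (x - z))\<^sup>2"
        using xs(2) by fastforce
      \<comment> \<open>Expanding the paraboloid around \<open>xs\<close> instead of
        \<open>z\<close> exhibits its gradient there.\<close>
      also have "\<dots> = phi xs + ((2 * C) *\<^sub>R (xs - z)) \<bullet> (x - xs) + C * (norm (x - xs))\<^sup>2"
        by (simp add: power2_norm_eq_inner inner_diff_left inner_diff_right inner_commute algebra_simps)
      finally show "phi x \<le> phi xs + ((2 * C) *\<^sub>R (xs - z)) \<bullet> (x - xs) + C * (norm (x - xs))\<^sup>2" .
    qed
    then have "xs \<in> D" using xs(1) rX by (auto simp: D_def)
    then show ?thesis using near r by force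
  qed
  then have "interior X \<subseteq> closure D"
    by (auto simp: closure_approachable)
  then have X_D: "X \<subseteq> closure D"
    using X_subset_closure_interior closure_mono[of "interior X" "closure D"] by simp
  show ?thesis
    unfolding c_convex_fun_iff
  proof
    fix x assume x: "x \<in> X"
    obtain a where a: "\<And>n. a n \<in> D" "a \<longlonglongrightarrow> x"
      by (rule mem_closure_LIMSEQ[OF X_D x]) blast
    then have aX: "a n \<in> X" for n by (auto simp: D_def)
    have "\<exists>y\<in>Y. \<forall>x'\<in>X. phi (a n) + c (a n) y \<le> phi x' + c x' y" for n
      using a(1)[of n] by (simp add: D_def)
    then obtain y where y: "\<And>n. y n \<in> Y"
      "\<And>n x'. x' \<in> X \<Longrightarrow> phi (a n) + c (a n) (y n) \<le> phi x' + c x' (y n)"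
      by metis
    obtain l r where l: "l \<in> Y" and r: "strict_mono (r::nat \<Rightarrow> nat)" and yl: "(y \<circ> r) \<longlonglongrightarrow> l"
      using compact_Y y(1) unfolding compact_def by metis
    have ar: "(a \<circ> r) \<longlonglongrightarrow> x"
      by (rule LIMSEQ_subseq_LIMSEQ[OF a(2) r])
    have "(\<lambda>n. phi ((a \<circ> r) n)) \<longlonglongrightarrow> phi x"
      by (rule continuous_on_tendsto_compose[OF phi_cont ar x]) (simp add: aX)
    moreover have "(\<lambda>n. c ((a \<circ> r) n) ((y \<circ> r) n)) \<longlonglongrightarrow> c x l"
      by (rule continuous_on_prod_LIMSEQ[OF c_cont ar yl]) (simp_all add: aX y x l)
    ultimately have lhs: "(\<lambda>n. phi ((a \<circ> r) n) + c ((a \<circ> r) n) ((y \<circ> r) n)) \<longlonglongrightarrow> phi x + c x l"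
      by (rule tendsto_add)
    have "phi x + c x l \<le> phi x' + c x' l" if x': "x' \<in> X" for x'
    proof (rule LIMSEQ_le[OF lhs])
      show "(\<lambda>n. phi x' + c x' ((y \<circ> r) n)) \<longlonglongrightarrow> phi x' + c x' l"
        by (intro tendsto_add tendsto_const continuous_on_tendsto_compose[OF c_cont_section_Y[OF x'] yl l])
          (simp add: y)
    qed (use y(2) x' in auto)
    then show "\<exists>y\<in>Y. \<forall>x'\<in>X. phi x + c x y \<le> phi x' + c x' y"
      using l by blast
  qed
qed

subsection \<open>Failure of Loeper's property\<close>

text \<open>Otherwise the difference would be constantly \<open>m\<close> on the open set
  \<open>V\<close>; its gradient in \<open>y\<close> would vanish and the twist would force
  \<open>b = xs\<close>.\<close>

lemma ex_nonmaximal: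
  assumes V: "open V" "V \<subseteq> Y" "V \<noteq> {}"
    and x: "xs \<in> X" "b \<in> X" "b \<noteq> xs"
    and le: "\<And>y. y \<in> V \<Longrightarrow> c xs y - c b y \<le> m"
  shows "\<exists>y\<in>V. c xs y - c b y < m"
proof (rule ccontr)
  assume contra: "\<not> (\<exists>y\<in>V. c xs y - c b y < m)"
  obtain y where y: "y \<in> V" using V by blast
  then have yY: "y \<in> Y" and at_y: "at y within Y = at y"
    using V by (blast, meson at_within_interior interior_maximal subsetD)
  have "((\<lambda>y. c xs y - c b y) has_derivative (\<lambda>k. Dyc xs y \<bullet> k - Dyc b y \<bullet> k)) (at y)"
    using has_derivative_diff[OF Dy[OF x(1) yY] Dy[OF x(2) yY]] unfolding at_y .
  moreover have "\<forall>\<^sub>F z in at y. c xs y - c b y \<le> c xs z - c b z"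
    using eventually_at_in_open'[OF V(1) y]
  proof eventually_elim
    case (elim z)
    then show ?case using contra le[OF y] by force
  qed
  ultimately have "(\<lambda>k. Dyc xs y \<bullet> k - Dyc b y \<bullet> k) = (\<lambda>k. 0)"
    by (rule has_derivative_local_min)
  then have "Dyc xs y \<bullet> k - Dyc b y \<bullet> k = 0" for k
    by (rule fun_cong)
  then have "(Dyc xs y - Dyc b y) \<bullet> (Dyc xs y - Dyc b y) = 0"
    unfolding inner_diff_left[of "Dyc xs y" "Dyc b y"] .
  then have "Dyc xs y = Dyc b y" by simp
  then show False
    using inj_onD[OF inj_Dyc[OF yY]] x by auto
qed

text \<open>The points of \<open>V\<close> strictly below \<open>m\<close> form a nonempty open set,
  on which \<open>ex_nonmaximal\<close> is applied once more.\<close>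

lemma ex_nonmaximal2:
  assumes V: "open V" "V \<subseteq> Y" "V \<noteq> {}"
    and x: "xs \<in> X" "a \<in> X" "a \<noteq> xs" "b \<in> X" "b \<noteq> xs"
    and le: "\<And>y. y \<in> V \<Longrightarrow> c xs y - c a y \<le> m" "\<And>y. y \<in> V \<Longrightarrow> c xs y - c b y \<le> m'"
  shows "\<exists>y\<in>V. c xs y - c a y < m \<and> c xs y - c b y < m'"
proof -
  define V' where "V' = V \<inter> (\<lambda>y. c xs y - c a y) -` {..<m}"
  have "open V'"
    unfolding V'_def
    by (intro continuous_open_preimage continuous_on_diff continuous_on_subset[OF c_cont_section_Y V(2)]
        x V open_lessThan)
  moreover have "V' \<noteq> {}"
    using ex_nonmaximal[OF V x(1-3) le(1)] by (auto simp: V'_def)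
  ultimately have "\<exists>y\<in>V'. c xs y - c b y < m'"
    using V(2) le(2) by (intro ex_nonmaximal x) (auto simp: V'_def)
  then show ?thesis by (auto simp: V'_def)
qed

text \<open>A small closed ball around \<open>y\<close> serves as \<open>V\<close>; invariance of
  domain for the coordinate map on its interior yields \<open>\<rho>\<close>.\<close>

lemma ex_neighbourhood:
  assumes xs: "xs \<in> X" and xh: "xh \<in> X" and y: "y \<in> interior Y" and less: "c xs y - c xh y < m"
  obtains V \<rho> where "V \<subseteq> Y" "compact V" "\<And>z. z \<in> V \<Longrightarrow> c xs z - c xh z < m"
    "\<rho> > 0" "ball (- Dxc xs y) \<rho> \<subseteq> (\<lambda>z. - Dxc xs z) ` interior V"
proof -
  define W where "W = interior Y \<inter> (\<lambda>z. c xs z - c xh z) -` {..<m}"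
  have "open W"
    unfolding W_def
    by (intro continuous_open_preimage continuous_on_diff open_interior open_lessThan
        continuous_on_subset[OF c_cont_section_Y interior_subset] xs xh)
  moreover have "y \<in> W" using y less by (simp add: W_def)
  ultimately obtain \<delta> where \<delta>: "\<delta> > 0" "cball y \<delta> \<subseteq> W"
    using open_contains_cball by blast
  have WY: "W \<subseteq> Y" using interior_subset by (auto simp: W_def)
  have ball_Y: "ball y \<delta> \<subseteq> Y" using \<delta>(2) WY ball_subset_cball by blast
  have "open ((\<lambda>z. - Dxc xs z) ` ball y \<delta>)"
    by (intro invariance_of_domain open_ball inj_on_subset[OF inj_Dxc[OF xs] ball_Y]
        continuous_on_subset[OF bitwisted_cost.Dyc_cont_section[OF swap xs] ball_Y])
  moreover have "- Dxc xs y \<in> (\<lambda>z. - Dxc xs z) ` ball y \<delta>"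
    using \<delta>(1) by (intro imageI) simp
  ultimately obtain \<rho> where "\<rho> > 0" "ball (- Dxc xs y) \<rho> \<subseteq> (\<lambda>z. - Dxc xs z) ` ball y \<delta>"
    using open_contains_ball by blast
  then show thesis
    using \<delta> WY by (intro that[of "cball y \<delta>" \<rho>]) (auto simp: interior_cball W_def)
qed

text \<open>Write \<open>d x y = c xs y - c x y\<close> and \<open>f = max d\<close> over neighbourhoods of \<open>y0\<close> and \<open>y1\<close>. Near \<open>xs\<close>
  the function \<open>f\<close> dominates \<open>d _ yt\<close> up to a conical gain, but \<open>f xh < d xh yt\<close>. Gluing \<open>d _ yt + \<eta>\<close>
  on top of \<open>f\<close> near \<open>xs\<close> forces \<open>yt\<close> as the only candidate for a support at \<open>xs\<close>, and that fails at
  \<open>xh\<close>. The chord condition survives for small \<open>\<eta>\<close> because it tests only two points at a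
  time and the twist lets us choose a \<open>y\<close> that is strictly nonmaximal for \<open>f\<close> at both.\<close>

lemma ex_alt_c_convex_not_c_convex:
  assumes xs: "xs \<in> interior X" and y: "y0 \<in> interior Y" "y1 \<in> interior Y" and xh: "xh \<in> X"
    and t: "0 \<le> t" "t \<le> 1" and yt: "yt \<in> Y"
    and eq: "- Dxc xs yt = t *\<^sub>R (- Dxc xs y1) + (1 - t) *\<^sub>R (- Dxc xs y0)"
    and viol: "c xs y0 - c xh y0 < c xs yt - c xh yt" "c xs y1 - c xh y1 < c xs yt - c xh yt"
  shows "\<exists>phi. alt_c_convex_fun X Y c phi \<and> \<not> c_convex_fun X Y c phi"
proof -
  have xsX: "xs \<in> X" using xs interior_subset by blast
  define d where "d x y = c xs y - c x y" for x y
  define Q where "Q y = - Dxc xs y" for y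
  define g where "g x = d x yt" for x
  obtain N0 \<rho>0 where N0: "N0 \<subseteq> Y" "compact N0" "\<And>z. z \<in> N0 \<Longrightarrow> d xh z < g xh"
    "\<rho>0 > 0" "ball (Q y0) \<rho>0 \<subseteq> Q ` interior N0"
    using ex_neighbourhood[OF xsX xh y(1) viol(1)] unfolding d_def g_def Q_def by metis
  obtain N1 \<rho>1 where N1: "N1 \<subseteq> Y" "compact N1" "\<And>z. z \<in> N1 \<Longrightarrow> d xh z < g xh"
    "\<rho>1 > 0" "ball (Q y1) \<rho>1 \<subseteq> Q ` interior N1"
    using ex_neighbourhood[OF xsX xh y(2) viol(2)] unfolding d_def g_def Q_def by metis
  define N where "N = N0 \<union> N1"
  have N: "N \<subseteq> Y" "compact N" "\<And>z. z \<in> N \<Longrightarrow> d xh z < g xh"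
    using N0 N1 by (auto simp: N_def)
  define \<epsilon> where "\<epsilon> = min \<rho>0 \<rho>1 / 4"
  have \<epsilon>: "\<epsilon> > 0" "2 * \<epsilon> < \<rho>0" "2 * \<epsilon> < \<rho>1"
    using N0(4) N1(4) by (auto simp: \<epsilon>_def min_def)
  \<comment> \<open>Both coordinates can be moved by the same vector in any direction, so a convex
    combination of the shifted points is \<open>Q yt\<close> moved by that vector.\<close>
  have shift: "\<exists>z0\<in>interior N0. \<exists>z1\<in>interior N1. Q z0 = Q y0 + (2 * \<epsilon>) *\<^sub>R u \<and> Q z1 = Q y1 + (2 * \<epsilon>) *\<^sub>R u"
    if u: "norm u = 1" for u
  proof -
    have "Q y0 + (2 * \<epsilon>) *\<^sub>R u \<in> ball (Q y0) \<rho>0" "Q y1 + (2 * \<epsilon>) *\<^sub>R u \<in> ball (Q y1) \<rho>1"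
      using u \<epsilon> by (auto simp: dist_norm)
    then have "Q y0 + (2 * \<epsilon>) *\<^sub>R u \<in> Q ` interior N0" "Q y1 + (2 * \<epsilon>) *\<^sub>R u \<in> Q ` interior N1"
      using N0(5) N1(5) by auto
    then obtain z0 z1 where "z0 \<in> interior N0" "Q y0 + (2 * \<epsilon>) *\<^sub>R u = Q z0"
      "z1 \<in> interior N1" "Q y1 + (2 * \<epsilon>) *\<^sub>R u = Q z1"
      by (elim imageE)
    then show ?thesis by (intro bexI[of _ z0] bexI[of _ z1]) auto
  qed
  have Q_yt: "Q yt = t *\<^sub>R Q y1 + (1 - t) *\<^sub>R Q y0"
    unfolding Q_def by (rule eq)
  have c_cont_Y: "continuous_on Y (d x)" if "x \<in> X" for x
    unfolding d_def by (intro continuous_intros c_cont_section_Y xsX that)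
  have d_lim: "(\<lambda>n. d (a n) z) \<longlonglongrightarrow> d l z"
    if "z \<in> Y" "a \<longlonglongrightarrow> l" "\<And>n. a n \<in> X" "l \<in> X" for a l z
    unfolding d_def
    by (intro tendsto_diff tendsto_const continuous_on_tendsto_compose[OF c_cont_section[OF that(1)] that(2)])
      (simp_all add: that)
  obtain u0 :: "real^'n" where u0: "norm u0 = 1"
    using vector_choose_size[of 1] by auto
  have N_ne: "N \<noteq> {}"
    using shift[OF u0] interior_subset by (auto simp: N_def)
  have "\<exists>m. (\<exists>z\<in>N. m = d x z) \<and> (\<forall>z\<in>N. d x z \<le> m)" if x: "x \<in> X" for x
  proof -
    obtain z where "z \<in> N" "\<forall>z'\<in>N. d x z' \<le> d x z"
      using continuous_attains_sup[OF N(2) N_ne continuous_on_subset[OF c_cont_Y[OF x] N(1)]] by blast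
    then show ?thesis by blast
  qed
  then obtain f where f: "\<And>x. x \<in> X \<Longrightarrow> \<exists>z\<in>N. f x = d x z" "\<And>x z. x \<in> X \<Longrightarrow> z \<in> N \<Longrightarrow> d x z \<le> f x"
    by metis
  have f_xs: "f xs = 0"
    using f(1)[OF xsX] by (auto simp: d_def)
  have f_xh: "f xh < g xh"
    using f(1)[OF xh] N(3) by auto
  have "\<epsilon> / 2 > 0" using \<epsilon> by simp
  then obtain r where r: "r > 0" "cball xs r \<subseteq> X"
    "\<And>x x' y. x \<in> cball xs r \<Longrightarrow> x' \<in> cball xs r \<Longrightarrow> y \<in> Y \<Longrightarrow>
      \<bar>c x y - c x' y - Dxc xs y \<bullet> (x - x')\<bar> \<le> \<epsilon> / 2 * norm (x - x')"
    using gradient_estimate[OF xs] by blast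
  \<comment> \<open>Shifting towards \<open>x\<close> gains \<open>2 * \<epsilon>\<close> times the
    distance; linearising \<open>f\<close> and \<open>g\<close> costs \<open>\<epsilon> / 2\<close>
    each.\<close>
  have cone: "g x + \<epsilon> * norm (x - xs) \<le> f x" if x: "x \<in> cball xs r" for x
  proof (cases "x = xs")
    case True
    then show ?thesis by (simp add: f_xs g_def d_def)
  next
    case False
    define w where "w = x - xs"
    define u where "u = (1 / norm w) *\<^sub>R w"
    have w: "w \<noteq> 0" using False by (simp add: w_def)
    then have u: "norm u = 1" "u \<bullet> w = norm w"
      by (simp_all add: u_def power2_norm_eq_inner[symmetric] power2_eq_square)
    obtain z0 z1 where z: "z0 \<in> N" "z1 \<in> N" "Q z0 = Q y0 + (2 * \<epsilon>) *\<^sub>R u" "Q z1 = Q y1 + (2 * \<epsilon>) *\<^sub>R u"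
      using shift[OF u(1)] interior_subset unfolding N_def by blast
    have xX: "x \<in> X" using r(2) x by blast
    have centre: "xs \<in> cball xs r" using r(1) by simp
    have est: "\<bar>d x z - Q z \<bullet> w\<bar> \<le> \<epsilon> / 2 * norm w" if "z \<in> Y" for z
      using r(3)[OF x centre that] unfolding d_def Q_def w_def inner_minus_left by linarith
    have "d x z0 \<ge> Q z0 \<bullet> w - \<epsilon> / 2 * norm w" "d x z1 \<ge> Q z1 \<bullet> w - \<epsilon> / 2 * norm w"
      using est[OF subsetD[OF N(1) z(1)]] est[OF subsetD[OF N(1) z(2)]] by linarith+
    then have "f x \<ge> Q z0 \<bullet> w - \<epsilon> / 2 * norm w" "f x \<ge> Q z1 \<bullet> w - \<epsilon> / 2 * norm w"
      using f(2)[OF xX z(1)] f(2)[OF xX z(2)] by linarith+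
    then have le0: "Q y0 \<bullet> w + 3 / 2 * (\<epsilon> * norm w) \<le> f x" and le1: "Q y1 \<bullet> w + 3 / 2 * (\<epsilon> * norm w) \<le> f x"
      unfolding z inner_add_left inner_scaleR_left u(2) by (auto simp: algebra_simps)
    have "t * (Q y1 \<bullet> w + 3 / 2 * (\<epsilon> * norm w)) + (1 - t) * (Q y0 \<bullet> w + 3 / 2 * (\<epsilon> * norm w))
        \<le> t * f x + (1 - t) * f x"
      using t by (intro add_mono mult_left_mono le0 le1) auto
    also have "\<dots> = f x" by (simp add: algebra_simps)
    also have "t * (Q y1 \<bullet> w + 3 / 2 * (\<epsilon> * norm w)) + (1 - t) * (Q y0 \<bullet> w + 3 / 2 * (\<epsilon> * norm w))
        = Q yt \<bullet> w + 3 / 2 * (\<epsilon> * norm w)"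
      unfolding Q_yt inner_add_left inner_scaleR_left by (simp add: algebra_simps diff_divide_distrib)
    finally show ?thesis
      using est[OF yt] unfolding g_def w_def[symmetric] by linarith
  qed
  have xh_far: "xh \<notin> cball xs r"
  proof
    assume "xh \<in> cball xs r"
    then have "g xh \<le> f xh"
      using cone[of xh] \<epsilon>(1) by (smt (verit) mult_nonneg_nonneg norm_ge_zero)
    then show False using f_xh by simp
  qed
  define phi where "phi \<eta> x = (if x \<in> cball xs r then max (f x) (g x + \<eta>) else f x)" for \<eta> x
  have not_c_convex: "\<not> c_convex_fun X Y c (phi \<eta>)" if \<eta>: "\<eta> > 0" for \<eta>
  proof
    assume "c_convex_fun X Y c (phi \<eta>)"
    then obtain z where z: "z \<in> Y" "\<And>x. x \<in> X \<Longrightarrow> phi \<eta> xs + c xs z \<le> phi \<eta> x + c x z"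
      using xsX unfolding c_convex_fun_iff by blast
    have "phi \<eta> xs = \<eta>"
      using r(1) \<eta> f_xs by (simp add: phi_def g_def d_def)
    then have z': "\<eta> + d x z \<le> phi \<eta> x" if "x \<in> X" for x
      using z(2)[OF that] by (simp add: d_def)
    have "\<eta> / 2 > 0" using \<eta> by simp
    then obtain s where s: "s > 0"
      "\<And>x x' y. x \<in> X \<Longrightarrow> x' \<in> X \<Longrightarrow> y \<in> Y \<Longrightarrow> dist x x' < s \<Longrightarrow> \<bar>c x y - c x' y\<bar> < \<eta> / 2"
      using c_equicontinuous by blast
    \<comment> \<open>Close to \<open>xs\<close> the bump is on top, so a support \<open>z\<close>
      at \<open>xs\<close> makes \<open>xs\<close> a local minimum of the difference of costs; equal
      gradients then give \<open>z = yt\<close>.\<close>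
    have near: "c xs z - c xs yt \<le> c x z - c x yt" if x: "x \<in> ball xs (min r s)" for x
    proof -
      have xX: "x \<in> X" and xr: "x \<in> cball xs r" and xd: "dist x xs < s"
        using x r(2) by (auto simp: dist_commute subset_iff)
      obtain v where v: "v \<in> N" "f x = d x v" using f(1)[OF xX] by blast
      have "\<bar>d x v\<bar> < \<eta> / 2" "\<bar>d x yt\<bar> < \<eta> / 2"
        using s(2)[OF xX xsX _ xd] v N(1) yt by (auto simp: d_def abs_minus_commute)
      then have "f x \<le> g x + \<eta>"
        unfolding g_def v(2) by linarith
      then have "phi \<eta> x = g x + \<eta>"
        using xr by (simp add: phi_def)
      then show ?thesis
        using z'[OF xX] by (simp add: g_def d_def)
    qed
    have at_xs: "at xs within X = at xs"
      by (rule at_within_interior[OF xs])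
    have "((\<lambda>x. c x z - c x yt) has_derivative (\<lambda>h. Dxc xs z \<bullet> h - Dxc xs yt \<bullet> h)) (at xs)"
      using has_derivative_diff[OF Dx[OF xsX z(1)] Dx[OF xsX yt]] unfolding at_xs .
    moreover have "\<forall>\<^sub>F x in at xs. c xs z - c xs yt \<le> c x z - c x yt"
    proof -
      have "\<forall>\<^sub>F x in at xs. x \<in> ball xs (min r s)"
        by (rule eventually_at_in_open') (use r s in auto)
      then show ?thesis by eventually_elim (rule near)
    qed
    ultimately have "(\<lambda>h. Dxc xs z \<bullet> h - Dxc xs yt \<bullet> h) = (\<lambda>h. 0)"
      by (rule has_derivative_local_min)
    then have "Dxc xs z \<bullet> h - Dxc xs yt \<bullet> h = 0" for h
      by (rule fun_cong)
    then have "(Dxc xs z - Dxc xs yt) \<bullet> (Dxc xs z - Dxc xs yt) = 0"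
      unfolding inner_diff_left[of "Dxc xs z" "Dxc xs yt"] .
    then have "z = yt"
      using inj_onD[OF inj_Dxc[OF xsX]] z(1) yt by auto
    then show False
      using z'[OF xh] f_xh xh_far \<eta> by (simp add: phi_def g_def)
  qed
  \<comment> \<open>Where \<open>phi \<eta> x = f x\<close>, a maximiser for \<open>f\<close> meets
    the chord condition, so failure occurs only on the bump. If both endpoints were in the ball,
    \<open>yt\<close> would do, so one endpoint \<open>b\<close> is outside. The disjunction lists
    two ways for \<open>z\<close> to be admissible at \<open>a\<close>.\<close>
  have failure: "\<exists>x a b. x \<in> cball xs r \<and> f x < g x + \<eta> \<and> a \<in> X \<and> b \<in> X \<and> b \<notin> cball xs r \<and>
      (\<forall>z\<in>Y. g x + \<eta> - d x z \<le> f a - d a z \<or> a \<in> cball xs r \<and> g x - d x z \<le> g a - d a z \<longrightarrow>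
        f b - d b z < g x + \<eta> - d x z)"
    if not_alt: "\<not> alt_c_convex_fun X Y c (phi \<eta>)" for \<eta>
  proof -
    have phi_f: "f v \<le> phi \<eta> v" for v by (simp add: phi_def)
    have phi_g: "g v + \<eta> \<le> phi \<eta> v" if "v \<in> cball xs r" for v using that by (simp add: phi_def)
    obtain p q x where pq: "p \<in> X" "q \<in> X" and x: "x \<in> X"
      and "\<not> (\<exists>z\<in>Y. phi \<eta> x + c x z \<le> phi \<eta> p + c p z \<and> phi \<eta> x + c x z \<le> phi \<eta> q + c q z)"
      using not_alt unfolding alt_c_convex_fun_iff by blast
    then have fail: "\<not> (phi \<eta> x - d x z \<le> phi \<eta> p - d p z \<and> phi \<eta> x - d x z \<le> phi \<eta> q - d q z)"
      if "z \<in> Y" for z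
      using that by (force simp: d_def)
    have "phi \<eta> x \<noteq> f x"
    proof
      assume eq: "phi \<eta> x = f x"
      obtain z where z: "z \<in> N" "f x = d x z" using f(1)[OF x] by blast
      show False
        using fail[of z] z N(1) f(2)[OF pq(1) z(1)] f(2)[OF pq(2) z(1)] phi_f[of p] phi_f[of q] eq by auto
    qed
    then have xr: "x \<in> cball xs r" and fx: "f x < g x + \<eta>" and phi_x: "phi \<eta> x = g x + \<eta>"
      by (auto simp: phi_def max_def split: if_splits)
    have "\<not> (p \<in> cball xs r \<and> q \<in> cball xs r)"
      using fail[OF yt] phi_g[of p] phi_g[of q] by (auto simp: phi_x g_def)
    then obtain a b where ab: "a \<in> X" "b \<in> X" "b \<notin> cball xs r"
      "\<And>z. z \<in> Y \<Longrightarrow> \<not> (phi \<eta> x - d x z \<le> phi \<eta> a - d a z \<and> phi \<eta> x - d x z \<le> phi \<eta> b - d b z)"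
      using fail pq by blast
    show ?thesis
    proof (intro exI conjI ballI impI)
      fix z assume z: "z \<in> Y" and
        "g x + \<eta> - d x z \<le> f a - d a z \<or> a \<in> cball xs r \<and> g x - d x z \<le> g a - d a z"
      then have "phi \<eta> x - d x z \<le> phi \<eta> a - d a z"
        unfolding phi_x using phi_f[of a] phi_g[of a] by linarith
      then have "\<not> phi \<eta> x - d x z \<le> phi \<eta> b - d b z"
        using ab(4)[OF z] by blast
      then show "f b - d b z < g x + \<eta> - d x z"
        unfolding phi_x using phi_f[of b] by linarith
    qed (fact xr fx ab)+
  qed
  have "\<exists>\<eta>>0. alt_c_convex_fun X Y c (phi \<eta>)"
  proof (rule ccontr)
    assume contra: "\<not> (\<exists>\<eta>>0. alt_c_convex_fun X Y c (phi \<eta>))"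
    define \<eta> where "\<eta> n = 1 / real (Suc n)" for n
    have "\<eta> n > 0" for n by (simp add: \<eta>_def)
    then have "\<not> alt_c_convex_fun X Y c (phi (\<eta> n))" for n using contra by blast
    then have "\<forall>n. \<exists>x a b. x \<in> cball xs r \<and> f x < g x + \<eta> n \<and> a \<in> X \<and> b \<in> X \<and> b \<notin> cball xs r \<and>
      (\<forall>z\<in>Y. g x + \<eta> n - d x z \<le> f a - d a z \<or> a \<in> cball xs r \<and> g x - d x z \<le> g a - d a z \<longrightarrow>
        f b - d b z < g x + \<eta> n - d x z)"
      using failure by blast
    then obtain x a b where xr: "\<And>n. x n \<in> cball xs r" and fx: "\<And>n. f (x n) < g (x n) + \<eta> n"
      and aX: "\<And>n. a n \<in> X" and bX: "\<And>n. b n \<in> X" and br: "\<And>n. b n \<notin> cball xs r"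
      and fail: "\<And>n z. z \<in> Y \<Longrightarrow> g (x n) + \<eta> n - d (x n) z \<le> f (a n) - d (a n) z \<or>
          a n \<in> cball xs r \<and> g (x n) - d (x n) z \<le> g (a n) - d (a n) z \<Longrightarrow>
        f (b n) - d (b n) z < g (x n) + \<eta> n - d (x n) z"
      unfolding choice_iff by blast
    have xX: "x n \<in> X" for n using xr r(2) by blast
    have \<eta>_lim: "\<eta> \<longlonglongrightarrow> 0"
      unfolding \<eta>_def by (rule LIMSEQ_Suc[OF lim_1_over_n])
    have x_lim: "x \<longlonglongrightarrow> xs"
    proof (rule LIMSEQ_I)
      fix e :: real assume e: "e > 0"
      then have "\<epsilon> * e > 0" using \<epsilon> by simp
      then have "\<forall>\<^sub>F n in sequentially. \<eta> n < \<epsilon> * e"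
        using order_tendstoD(2)[OF \<eta>_lim] by blast
      then have "\<forall>\<^sub>F n in sequentially. norm (x n - xs) < e"
      proof eventually_elim
        case (elim n)
        have "\<epsilon> * norm (x n - xs) < \<epsilon> * e"
          using cone[OF xr[of n]] fx[of n] elim by linarith
        then show ?case using \<epsilon>(1) by simp
      qed
      then show "\<exists>no. \<forall>n\<ge>no. norm (x n - xs) < e"
        by (simp add: eventually_sequentially)
    qed
    \<comment> \<open>Unit direction from \<open>a n\<close> to \<open>x n\<close>; the default
      \<open>u0\<close> keeps \<open>u\<close> on the sphere when the points coincide, so a limit
      direction always exists.\<close>
    define u where "u n = (if x n = a n then u0 else (1 / norm (x n - a n)) *\<^sub>R (x n - a n))" for n
    have u: "norm (u n) = 1" "x n - a n = norm (x n - a n) *\<^sub>R u n" for n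
      by (simp_all add: u_def u0)
    have "compact (X \<times> X \<times> sphere (0 :: real^'n) 1)"
      by (intro compact_Times compact_X compact_sphere)
    moreover have "(a n, b n, u n) \<in> X \<times> X \<times> sphere 0 1" for n
      using aX bX u by simp
    ultimately obtain L s where L: "L \<in> X \<times> X \<times> sphere 0 1" "strict_mono (s::nat \<Rightarrow> nat)"
      "((\<lambda>n. (a n, b n, u n)) \<circ> s) \<longlonglongrightarrow> L"
      unfolding compact_def by meson
    obtain al bl ul where L_eq: "L = (al, bl, ul)" by (cases L)
    have al: "al \<in> X" and bl: "bl \<in> X" and ul: "norm ul = 1"
      using L(1) by (auto simp: L_eq)
    have a_lim: "(\<lambda>n. a (s n)) \<longlonglongrightarrow> al" and b_lim: "(\<lambda>n. b (s n)) \<longlonglongrightarrow> bl" and u_lim: "(\<lambda>n. u (s n)) \<longlonglongrightarrow> ul"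
      using tendsto_fst[OF L(3)] tendsto_fst[OF tendsto_snd[OF L(3)]] tendsto_snd[OF tendsto_snd[OF L(3)]]
      by (simp_all add: L_eq comp_def)
    have xs_lim: "(\<lambda>n. x (s n)) \<longlonglongrightarrow> xs" and \<eta>s_lim: "(\<lambda>n. \<eta> (s n)) \<longlonglongrightarrow> 0"
      using LIMSEQ_subseq_LIMSEQ[OF x_lim L(2)] LIMSEQ_subseq_LIMSEQ[OF \<eta>_lim L(2)]
      by (simp_all add: comp_def)
    have "r \<le> dist xs bl"
      by (rule LIMSEQ_le_const[OF tendsto_dist[OF tendsto_const b_lim]]) (use br in \<open>auto simp: less_imp_le not_le\<close>)
    then have bl_ne: "bl \<noteq> xs" using r(1) by auto
    have w_lim: "(\<lambda>n. g (x (s n)) + \<eta> (s n) - d (x (s n)) z) \<longlonglongrightarrow> 0" if "z \<in> Y" for z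
    proof -
      have "(\<lambda>n. g (x (s n)) + \<eta> (s n) - d (x (s n)) z) \<longlonglongrightarrow> d xs yt + 0 - d xs z"
        unfolding g_def by (intro tendsto_add tendsto_diff d_lim xs_lim \<eta>s_lim that yt xX xsX)
      then show ?thesis by (simp add: d_def)
    qed
    \<comment> \<open>The left side tends to 0, while strict nonmaximality of \<open>z\<close> at
      the limit \<open>l\<close> keeps the right side above a positive bound.\<close>
    have slack: "\<forall>\<^sub>F n in sequentially. g (x (s n)) + \<eta> (s n) - d (x (s n)) z < f (v (s n)) - d (v (s n)) z"
      if z: "z \<in> Y" "d l z < f l" and v: "\<And>n. v n \<in> X" "(\<lambda>n. v (s n)) \<longlonglongrightarrow> l" "l \<in> X" for z v l
    proof -
      obtain z' where z': "z' \<in> N" "f l = d l z'" using f(1)[OF v(3)] by blast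
      have "(\<lambda>n. d (v (s n)) z' - d (v (s n)) z) \<longlonglongrightarrow> d l z' - d l z"
        by (intro tendsto_diff d_lim v z subsetD[OF N(1) z'(1)])
      from tendsto_diff[OF this w_lim[OF z(1)]]
      have "\<forall>\<^sub>F n in sequentially. 0 < d (v (s n)) z' - d (v (s n)) z - (g (x (s n)) + \<eta> (s n) - d (x (s n)) z)"
        using z(2) z'(2) by (intro order_tendstoD(1)) auto
      then show ?thesis
      proof eventually_elim
        case (elim n)
        then show ?case using f(2)[OF v(1) z'(1), of "s n"] by linarith
      qed
    qed
    have le_f: "c xs z - c v z \<le> f v" if "v \<in> X" "z \<in> interior N" for v z
      using f(2)[OF that(1) subsetD[OF interior_subset that(2)]] by (simp add: d_def)
    have NY: "interior N \<subseteq> Y" using interior_subset N(1) by blast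
    show False
    proof (cases "al = xs")
      case False
      have N_int: "interior N \<noteq> {}"
        using shift[OF u0] interior_mono[of N0 N] by (auto simp: N_def)
      have "\<exists>z\<in>interior N. c xs z - c al z < f al \<and> c xs z - c bl z < f bl"
        by (rule ex_nonmaximal2[OF open_interior NY N_int xsX al False bl bl_ne])
          (simp_all add: le_f al bl)
      then obtain z where z: "z \<in> interior N" "d al z < f al" "d bl z < f bl"
        unfolding d_def by blast
      then have zY: "z \<in> Y" using interior_subset N(1) by blast
      have "\<forall>\<^sub>F n in sequentially. False"
        using slack[OF zY z(2) aX a_lim al] slack[OF zY z(3) bX b_lim bl]
      proof eventually_elim
        case (elim n)
        then show ?case using fail[OF zY, of "s n"] by linarith
      qed
      then show False by simp
    next
      case True
      \<comment> \<open>With \<open>al = xs\<close> there is no slack at \<open>a\<close>, since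
        \<open>f\<close> and every \<open>d _ z\<close> vanish there. For \<open>z\<close> in
        \<open>V\<close> the function \<open>g - d _ z\<close> instead decreases from
        \<open>a\<close> to \<open>x\<close>, which is the second alternative in
        \<open>fail\<close>.\<close>
      define V where "V = interior N \<inter> (\<lambda>z. (Q z - Q yt) \<bullet> ul) -` {0<..}"
      have "open V"
        unfolding V_def Q_def
        by (intro continuous_open_preimage open_interior open_greaterThan continuous_on_inner
            continuous_on_diff continuous_on_const
            continuous_on_subset[OF bitwisted_cost.Dyc_cont_section[OF swap xsX] NY])
      moreover have "V \<noteq> {}"
      proof -
        obtain z0 z1 where z: "z0 \<in> interior N0" "z1 \<in> interior N1"
          "Q z0 = Q y0 + (2 * \<epsilon>) *\<^sub>R ul" "Q z1 = Q y1 + (2 * \<epsilon>) *\<^sub>R ul"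
          using shift[OF ul] by blast
        then have zN: "z0 \<in> interior N" "z1 \<in> interior N"
          using interior_mono[of N0 N] interior_mono[of N1 N] by (auto simp: N_def)
        have "t *\<^sub>R Q z1 + (1 - t) *\<^sub>R Q z0 - Q yt = (2 * \<epsilon>) *\<^sub>R ul"
          unfolding z Q_yt by (simp add: algebra_simps)
        then have "(t *\<^sub>R Q z1 + (1 - t) *\<^sub>R Q z0 - Q yt) \<bullet> ul = 2 * \<epsilon>"
          using ul by (simp add: power2_norm_eq_inner[symmetric])
        then have "t * ((Q z1 - Q yt) \<bullet> ul) + (1 - t) * ((Q z0 - Q yt) \<bullet> ul) > 0"
          using \<epsilon>(1) by (simp add: inner_diff_left inner_add_left algebra_simps)
        then have "(Q z1 - Q yt) \<bullet> ul > 0 \<or> (Q z0 - Q yt) \<bullet> ul > 0"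
          using t by (smt (verit) mult_nonneg_nonpos)
        then show ?thesis using zN by (auto simp: V_def)
      qed
      moreover have "V \<subseteq> Y" using NY by (auto simp: V_def)
      moreover have "c xs z - c bl z \<le> f bl" if "z \<in> V" for z
        using that by (intro le_f bl) (simp add: V_def)
      ultimately have "\<exists>z\<in>V. c xs z - c bl z < f bl"
        by (intro ex_nonmaximal[OF _ _ _ xsX bl bl_ne])
      then obtain z where z: "z \<in> V" "d bl z < f bl" unfolding d_def by blast
      then have zY: "z \<in> Y" and zu: "(Q z - Q yt) \<bullet> ul > 0" using NY by (auto simp: V_def)
      \<comment> \<open>The margin \<open>2 * e\<close> absorbs the linearisation errors for
        \<open>z\<close> and for \<open>yt\<close>, each at most \<open>e\<close> times the
        distance.\<close>
      define e where "e = (Q z - Q yt) \<bullet> ul / 4"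
      have e: "e > 0" "2 * e < (Q z - Q yt) \<bullet> ul" using zu by (simp_all add: e_def)
      obtain r' where r': "r' > 0" "cball xs r' \<subseteq> X"
        "\<And>x x' y. x \<in> cball xs r' \<Longrightarrow> x' \<in> cball xs r' \<Longrightarrow> y \<in> Y \<Longrightarrow>
          \<bar>c x y - c x' y - Dxc xs y \<bullet> (x - x')\<bar> \<le> e * norm (x - x')"
        using gradient_estimate[OF xs e(1)] by blast
      have close: "\<forall>\<^sub>F n in sequentially. v n \<in> cball xs p" if "v \<longlonglongrightarrow> xs" "p > 0" for v p
        using tendstoD[OF that] by eventually_elim (simp add: dist_commute)
      have "(\<lambda>n. (Q z - Q yt) \<bullet> u (s n)) \<longlonglongrightarrow> (Q z - Q yt) \<bullet> ul"
        by (intro tendsto_inner tendsto_const u_lim)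
      then have ev_u: "\<forall>\<^sub>F n in sequentially. 2 * e < (Q z - Q yt) \<bullet> u (s n)"
        using e(2) by (rule order_tendstoD(1))
      have "\<forall>\<^sub>F n in sequentially. False"
        using close[OF xs_lim r'(1)] close[OF a_lim[unfolded True] r'(1)]
          close[OF a_lim[unfolded True] r(1)] ev_u slack[OF zY z(2) bX b_lim bl]
      proof eventually_elim
        case (elim n)
        let ?x = "x (s n)" and ?a = "a (s n)"
        let ?w = "norm (?x - ?a)"
        have "(Q z - Q yt) \<bullet> (?x - ?a) = ?w * ((Q z - Q yt) \<bullet> u (s n))"
          by (subst u(2)[of "s n"]) simp
        moreover have "?w * (2 * e) \<le> ?w * ((Q z - Q yt) \<bullet> u (s n))"
          using elim(4) by (intro mult_left_mono) auto
        ultimately have "2 * (e * ?w) \<le> (Q z - Q yt) \<bullet> (?x - ?a)"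
          by (simp add: algebra_simps)
        moreover have "(Q z - Q yt) \<bullet> (?x - ?a) = Dxc xs yt \<bullet> (?x - ?a) - Dxc xs z \<bullet> (?x - ?a)"
          by (simp add: Q_def inner_diff_left)
        ultimately have "g ?x - d ?x z \<le> g ?a - d ?a z"
          using r'(3)[OF elim(1,2) zY] r'(3)[OF elim(1,2) yt] unfolding g_def d_def by linarith
        then show ?case using fail[OF zY, of "s n"] elim(3,5) by linarith
      qed
      then show False by simp
    qed
  qed
  then show ?thesis using not_c_convex by blast
qed

section \<open>Loeper's property characterised by the two notions of convexity\<close>

lemma loeper_iff_interior: "loeper X Y c Dyc \<longleftrightarrow> loeper_on X (interior X) (interior Y) c Dyc"
  using loeper_on_interior_imp loeper_on_mono[OF _ interior_subset interior_subset]
  unfolding loeper_iff by blast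

text \<open>Both directions pass through the dual property on interiors, where duality and the
  counterexample can differentiate freely; density extends the dual property to the full sets for
  the positive direction.\<close>

lemma loeper_iff_alt_c_convex_imp_c_convex:
  "loeper X Y c Dyc \<longleftrightarrow> (\<forall>phi. alt_c_convex_fun X Y c phi \<longrightarrow> c_convex_fun X Y c phi)"
proof
  assume "loeper X Y c Dyc"
  then have "loeper_on Y (interior Y) (interior X) (\<lambda>y x. c x y) (\<lambda>y x. Dxc x y)"
    unfolding loeper_iff_interior loeper_on_interior_dual_iff .
  then have "loeper_on Y Y X (\<lambda>y x. c x y) (\<lambda>y x. Dxc x y)"
    by (rule bitwisted_cost.loeper_on_interior_imp[OF swap])
  then show "\<forall>phi. alt_c_convex_fun X Y c phi \<longrightarrow> c_convex_fun X Y c phi"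
    using alt_c_convex_imp_c_convex by blast
next
  assume all: "\<forall>phi. alt_c_convex_fun X Y c phi \<longrightarrow> c_convex_fun X Y c phi"
  have "loeper_on Y (interior Y) (interior X) (\<lambda>y x. c x y) (\<lambda>y x. Dxc x y)"
    unfolding loeper_on_def
  proof (intro ballI impI, rule ccontr)
    fix y0 y1 xs xh yt and t :: real
    assume *: "y0 \<in> interior Y" "y1 \<in> interior Y" "xs \<in> interior X" "xh \<in> interior X" "t \<in> {0..1}" "yt \<in> Y"
      "- Dxc xs yt = t *\<^sub>R (- Dxc xs y1) + (1 - t) *\<^sub>R (- Dxc xs y0)"
      "\<not> - c xh yt + c xs yt \<le> max (- c xh y0 + c xs y0) (- c xh y1 + c xs y1)"
    have "\<exists>phi. alt_c_convex_fun X Y c phi \<and> \<not> c_convex_fun X Y c phi"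
    proof (rule ex_alt_c_convex_not_c_convex[OF *(3,1,2) _ _ _ *(6,7)])
      show "xh \<in> X" using *(4) interior_subset by blast
      show "0 \<le> t" "t \<le> 1" using *(5) by auto
      show "c xs y0 - c xh y0 < c xs yt - c xh yt" "c xs y1 - c xh y1 < c xs yt - c xh yt"
        using *(8) by auto
    qed
    then show False using all by blast
  qed
  then show "loeper X Y c Dyc"
    unfolding loeper_iff_interior loeper_on_interior_dual_iff .
qed

end

theorem theorem1p1:
  fixes X Y :: "(real^'n) set"
    and c :: "real^'n \<Rightarrow> real^'n \<Rightarrow> real"
    and Dxc Dyc :: "real^'n \<Rightarrow> real^'n \<Rightarrow> real^'n"
    and Dxy Dyx :: "real^'n \<Rightarrow> real^'n \<Rightarrow> real^'n^'n"
  assumes "compact X" and "compact Y"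
    and "interior X \<noteq> {}" and "interior Y \<noteq> {}"
    and c_cont: "continuous_on (X \<times> Y) (\<lambda>(x, y). c x y)"
    and Dx: "\<And>x y. x \<in> X \<Longrightarrow> y \<in> Y \<Longrightarrow>
               ((\<lambda>x'. c x' y) has_derivative (\<lambda>h. Dxc x y \<bullet> h)) (at x within X)"
    and Dy: "\<And>x y. x \<in> X \<Longrightarrow> y \<in> Y \<Longrightarrow>
               ((\<lambda>y'. c x y') has_derivative (\<lambda>k. Dyc x y \<bullet> k)) (at y within Y)"
    and Dxy: "\<And>x y. x \<in> X \<Longrightarrow> y \<in> Y \<Longrightarrow>
               ((\<lambda>y'. Dxc x y') has_derivative (\<lambda>k. Dxy x y *v k)) (at y within Y)"
    and Dyx: "\<And>x y. x \<in> X \<Longrightarrow> y \<in> Y \<Longrightarrow>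
               ((\<lambda>x'. Dyc x' y) has_derivative (\<lambda>h. Dyx x y *v h)) (at x within X)"
    and "continuous_on (X \<times> Y) (\<lambda>(x, y). Dxc x y)"
    and "continuous_on (X \<times> Y) (\<lambda>(x, y). Dyc x y)"
    and "continuous_on (X \<times> Y) (\<lambda>(x, y). Dxy x y)"
    and "continuous_on (X \<times> Y) (\<lambda>(x, y). Dyx x y)"
    and "\<And>x y. x \<in> X \<Longrightarrow> y \<in> Y \<Longrightarrow> Dxy x y = transpose (Dyx x y)"
    and "bi_twisted X Y Dxc Dyc"
    and "non_degenerate X Y Dxy"
    and "X_c_convex X Y Dyc"
    and "Y_c_convex X Y Dxc"
  shows "(loeper X Y c Dyc \<longrightarrow>
            (\<forall>phi :: real^'n \<Rightarrow> real. c_convex_fun X Y c phi \<longleftrightarrow> alt_c_convex_fun X Y c phi))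
       \<and> (\<not> loeper X Y c Dyc \<longrightarrow>
            (\<exists>phi :: real^'n \<Rightarrow> real. alt_c_convex_fun X Y c phi \<and> \<not> c_convex_fun X Y c phi))"
proof -
  have inv: "invertible (Dxy x y)" "invertible (Dyx x y)" if "x \<in> X" "y \<in> Y" for x y
  proof -
    show "invertible (Dxy x y)"
      using assms(16) that by (auto simp: non_degenerate_def)
    then show "invertible (Dyx x y)"
      using assms(14)[OF that] by (metis transpose_invertible transpose_transpose)
  qed
  interpret bitwisted_cost X Y c Dxc Dyc Dxy Dyx
  proof
    show "inj_on (\<lambda>y. - Dxc x y) Y" if "x \<in> X" for x
      using assms(15) that by (auto simp: bi_twisted_def)
    show "inj_on (\<lambda>x. - Dyc x y) X" if "y \<in> Y" for y
      using assms(15) that by (auto simp: bi_twisted_def)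
    show "convex ((\<lambda>x. - Dyc x y) ` X)" if "y \<in> Y" for y
      using assms(17) that by (auto simp: X_c_convex_def c_image_X_def)
    show "convex ((\<lambda>y. - Dxc x y) ` Y)" if "x \<in> X" for x
      using assms(18) that by (auto simp: Y_c_convex_def c_image_Y_def)
  qed (fact assms inv)+
  show ?thesis
    using loeper_iff_alt_c_convex_imp_c_convex c_convex_imp_alt_c_convex by blast
qed

end
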